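(* Let $k$ be a field, $S=k[x_1,\dots,x_n]$, and let $I\subseteq S$ be a nonzero monomial ideal with minimal monomial generators $f_1,\dots,f_r$. Then $$\operatorname{reg}(I)=\sup\{\,j-i \;:\; \tilde H_i(L_j(I);k)\neq 0\,\}.$$
   Context: For an integer $j$, the $j$-th LCM complex of $I$ is the simplicial complex on $[r]$ given by $L_j(I)=\{F\subseteq[r] : |\operatorname{lcm}_{i\in F}(f_i)|\le j\}$, where $|m|$ denotes the total degree of a monomial $m$ (and the lcm over the empty set is $1$). $\operatorname{reg}(I)$ is the Castelnuovo–Mumford regularity of $I$ as a graded $S$-module. $\tilde H_i$ is reduced simplicial homology with coefficients in $k$.
   Formalization: The supremum of the empty set is taken to be 0: for I = S (r = 1, f_1 = 1) every L_j(I) is void or a full simplex, so the set on the right is empty although reg(S) = 0; for proper I the set is nonempty and the supremum is the usual one. *)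

theory Defs
  imports "HOL-Library.Poly_Mapping" "HOL-Library.Function_Algebras" "HOL-Library.Extended_Real"
begin

type_synonym 'n mon = "'n \<Rightarrow>\<^sub>0 nat"

text \<open>The variables are the elements of a finite type \<open>'n\<close>, so that \<open>n = CARD('n)\<close> and
  \<open>('n, 'k) mpol\<close> is the polynomial ring \<open>S\<close> with the ring structure of
  \<^theory>\<open>HOL-Library.Poly_Mapping\<close>.\<close>

type_synonym ('n, 'k) mpol = "'n mon \<Rightarrow>\<^sub>0 'k"

definition mon_deg :: "'n::finite mon \<Rightarrow> nat" where
  "mon_deg m = (\<Sum>x\<in>UNIV. Poly_Mapping.lookup m x)"

definition mon_lcm :: "(nat \<Rightarrow> 'n::finite mon) \<Rightarrow> nat set \<Rightarrow> 'n mon" where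
  "mon_lcm f F =
     Abs_poly_mapping (\<lambda>x. Max (insert 0 ((\<lambda>l. Poly_Mapping.lookup (f l) x) ` F)))"

lemma lookup_mon_lcm:
  "Poly_Mapping.lookup (mon_lcm f F) x = Max (insert 0 ((\<lambda>l. Poly_Mapping.lookup (f l) x) ` F))"
  unfolding mon_lcm_def by (subst lookup_Abs_poly_mapping) simp_all

abbreviation monomial :: "'n::finite mon \<Rightarrow> ('n, 'k::field) mpol" where
  "monomial m \<equiv> Poly_Mapping.single m 1"

subsection \<open>Monomial ideals\<close>

lemma module_mult: "module ((*) :: 'a::comm_ring_1 \<Rightarrow> 'a \<Rightarrow> 'a)"
  by unfold_locales (simp_all add: algebra_simps)

definition ideal_gen :: "'a::comm_ring_1 set \<Rightarrow> 'a set" where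
  "ideal_gen G = module.span (*) G"

definition monomial_ideal :: "('n::finite, 'k::field) mpol set \<Rightarrow> bool" where
  "monomial_ideal I \<longleftrightarrow> (\<exists>A. I = ideal_gen (monomial ` A))"

text \<open>Generators are removed by index, so minimality also makes \<open>f 1, \<dots>, f r\<close> distinct.\<close>

definition min_mon_gens :: "('n::finite, 'k::field) mpol set \<Rightarrow> nat \<Rightarrow> (nat \<Rightarrow> 'n mon) \<Rightarrow> bool" where
  "min_mon_gens I r f \<longleftrightarrow>
     ideal_gen ((\<lambda>l. monomial (f l)) ` {1..r}) = I \<and>
     (\<forall>i\<in>{1..r}. ideal_gen ((\<lambda>l. monomial (f l)) ` ({1..r} - {i})) \<noteq> I)"

definition lcm_complex :: "nat \<Rightarrow> (nat \<Rightarrow> 'n::finite mon) \<Rightarrow> int \<Rightarrow> nat set set" where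
  "lcm_complex r f j = {F. F \<subseteq> {1..r} \<and> int (mon_deg (mon_lcm f F)) \<le> j}"

subsection \<open>Homology\<close>

text \<open>The quotient group \<open>Z/B\<close> as a set of cosets; it is zero iff its only element is the
  coset \<open>B\<close> of \<open>0\<close>.\<close>

definition quotient_group :: "'a::ab_group_add set \<Rightarrow> 'a set \<Rightarrow> 'a set set" where
  "quotient_group Z B = (\<lambda>z. (+) z ` B) ` Z"

text \<open>In the augmented chain complex \<open>{}\<close> is the face of dimension \<open>-1\<close>. Hence the complex
  \<open>{{}}\<close> has homology in degree \<open>-1\<close>, and the void complex \<open>{}\<close> has no homology at all.\<close>

definition chains :: "nat set set \<Rightarrow> int \<Rightarrow> (nat set \<Rightarrow>\<^sub>0 'k::field) set" where
  "chains K i = {c. \<forall>F\<in>Poly_Mapping.keys c. F \<in> K \<and> finite F \<and> int (card F) = i + 1}"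

definition bdry :: "(nat set \<Rightarrow>\<^sub>0 'k::field) \<Rightarrow> (nat set \<Rightarrow>\<^sub>0 'k)" where
  "bdry c = (\<Sum>F\<in>Poly_Mapping.keys c. \<Sum>v\<in>F.
     Poly_Mapping.single (F - {v}) ((-1) ^ card {w \<in> F. w < v} * Poly_Mapping.lookup c F))"

definition cycles :: "nat set set \<Rightarrow> int \<Rightarrow> (nat set \<Rightarrow>\<^sub>0 'k::field) set" where
  "cycles K i = {c \<in> chains K i. bdry c = 0}"

definition boundaries :: "nat set set \<Rightarrow> int \<Rightarrow> (nat set \<Rightarrow>\<^sub>0 'k::field) set" where
  "boundaries K i = bdry ` chains K (i + 1)"

definition reduced_homology :: "nat set set \<Rightarrow> int \<Rightarrow> (nat set \<Rightarrow>\<^sub>0 'k::field) set set" where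
  "reduced_homology K i = quotient_group (cycles K i) (boundaries K i)"

definition reduced_homology_nonzero :: "'k::field itself \<Rightarrow> nat set set \<Rightarrow> int \<Rightarrow> bool" where
  "reduced_homology_nonzero T K i \<longleftrightarrow>
     (reduced_homology K i :: (nat set \<Rightarrow>\<^sub>0 'k) set set) \<noteq> {boundaries K i}"

subsection \<open>Graded free resolutions, Tor and regularity\<close>

definition homogeneous :: "int \<Rightarrow> ('n::finite, 'k::field) mpol \<Rightarrow> bool" where
  "homogeneous d p \<longleftrightarrow> (\<forall>m\<in>Poly_Mapping.keys p. int (mon_deg m) = d)"

text \<open>The data of a sequence \<open>\<dots> \<rightarrow> F\<^sub>1 \<rightarrow> F\<^sub>0 \<rightarrow> S\<close> of graded free modules, where \<open>F\<^sub>i\<close> has a basis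
  \<open>e\<^sub>b\<close> (\<open>b < rk i\<close>) with \<open>e\<^sub>b\<close> of degree \<open>gdeg i b\<close>. The map \<open>F\<^sub>0 \<rightarrow> S\<close> sends \<open>e\<^sub>b\<close> to \<open>aug b\<close>, and
  \<open>diff i a b\<close> is the matrix entry in row \<open>a\<close>, column \<open>b\<close> of \<open>F\<^bsub>i+1\<^esub> \<rightarrow> F\<^sub>i\<close>.\<close>

record 'a free_data =
  rk :: "nat \<Rightarrow> nat"
  gdeg :: "nat \<Rightarrow> nat \<Rightarrow> int"
  aug :: "nat \<Rightarrow> 'a"
  diff :: "nat \<Rightarrow> nat \<Rightarrow> nat \<Rightarrow> 'a"

definition free_mod :: "nat \<Rightarrow> (nat \<Rightarrow> 'a::comm_ring_1) set" where
  "free_mod r = {v. \<forall>b. r \<le> b \<longrightarrow> v b = 0}"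

definition mat_map ::
    "nat \<Rightarrow> nat \<Rightarrow> (nat \<Rightarrow> nat \<Rightarrow> 'a::comm_ring_1) \<Rightarrow> (nat \<Rightarrow> 'a) \<Rightarrow> (nat \<Rightarrow> 'a)" where
  "mat_map s r A v = (\<lambda>a. if a < s then \<Sum>b<r. A a b * v b else 0)"

definition diff_map :: "'a::comm_ring_1 free_data \<Rightarrow> nat \<Rightarrow> (nat \<Rightarrow> 'a) \<Rightarrow> (nat \<Rightarrow> 'a)" where
  "diff_map R i = mat_map (rk R i) (rk R (Suc i)) (diff R i)"

definition aug_map :: "'a::comm_ring_1 free_data \<Rightarrow> (nat \<Rightarrow> 'a) \<Rightarrow> 'a" where
  "aug_map R v = (\<Sum>b<rk R 0. aug R b * v b)"

text \<open>\<open>R\<close> is a graded free resolution of \<open>I\<close>, graded as a submodule of \<open>S\<close>, by modules of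
  finite rank and maps of degree \<open>0\<close>.\<close>

definition graded_free_resolution ::
    "('n::finite, 'k::field) mpol set \<Rightarrow> ('n, 'k) mpol free_data \<Rightarrow> bool" where
  "graded_free_resolution I R \<longleftrightarrow>
     (\<forall>b<rk R 0. homogeneous (gdeg R 0 b) (aug R b)) \<and>
     (\<forall>i. \<forall>a<rk R i. \<forall>b<rk R (Suc i).
        homogeneous (gdeg R (Suc i) b - gdeg R i a) (diff R i a b)) \<and>
     aug_map R ` free_mod (rk R 0) = I \<and>
     {v \<in> free_mod (rk R 0). aug_map R v = 0} = diff_map R 0 ` free_mod (rk R 1) \<and>
     (\<forall>i. {v \<in> free_mod (rk R (Suc i)). diff_map R i v = 0} =
        diff_map R (Suc i) ` free_mod (rk R (Suc (Suc i))))"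

text \<open>Tensoring with \<open>k = S/(x\<^sub>1, \<dots>, x\<^sub>n)\<close> turns \<open>F\<^sub>i\<close> into the \<open>k\<close>-space with the same graded
  basis and replaces each matrix entry by its constant coefficient. The degree \<open>j\<close> part is
  spanned by the basis elements of degree \<open>j\<close>.\<close>

definition tensor_k :: "('n::finite, 'k::field) mpol free_data \<Rightarrow> nat \<Rightarrow> int \<Rightarrow> (nat \<Rightarrow> 'k) set" where
  "tensor_k R i j = {v \<in> free_mod (rk R i). \<forall>b. v b \<noteq> 0 \<longrightarrow> gdeg R i b = j}"

definition diff_k ::
    "('n::finite, 'k::field) mpol free_data \<Rightarrow> nat \<Rightarrow> (nat \<Rightarrow> 'k) \<Rightarrow> (nat \<Rightarrow> 'k)" where
  "diff_k R i =
     mat_map (rk R i) (rk R (Suc i)) (\<lambda>a b. Poly_Mapping.lookup (diff R i a b) 0)"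

definition tor_cycles ::
    "('n::finite, 'k::field) mpol free_data \<Rightarrow> nat \<Rightarrow> int \<Rightarrow> (nat \<Rightarrow> 'k) set" where
  "tor_cycles R i j =
     {v \<in> tensor_k R i j. case i of 0 \<Rightarrow> True | Suc h \<Rightarrow> diff_k R h v = 0}"

definition tor_boundaries ::
    "('n::finite, 'k::field) mpol free_data \<Rightarrow> nat \<Rightarrow> int \<Rightarrow> (nat \<Rightarrow> 'k) set" where
  "tor_boundaries R i j = diff_k R i ` tensor_k R (Suc i) j"

definition chosen_resolution ::
    "('n::finite, 'k::field) mpol set \<Rightarrow> ('n, 'k) mpol free_data" where
  "chosen_resolution I = (SOME R. graded_free_resolution I R)"

text \<open>The graded piece of degree \<open>j\<close> of \<open>Tor\<^sub>i(I, k)\<close>.\<close>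

definition Tor :: "('n::finite, 'k::field) mpol set \<Rightarrow> nat \<Rightarrow> int \<Rightarrow> (nat \<Rightarrow> 'k) set set" where
  "Tor I i j = quotient_group (tor_cycles (chosen_resolution I) i j)
                              (tor_boundaries (chosen_resolution I) i j)"

definition Tor_nonzero :: "('n::finite, 'k::field) mpol set \<Rightarrow> nat \<Rightarrow> int \<Rightarrow> bool" where
  "Tor_nonzero I i j \<longleftrightarrow> Tor I i j \<noteq> {tor_boundaries (chosen_resolution I) i j}"

text \<open>Castelnuovo--Mumford regularity: the supremum of \<open>j - i\<close> over the nonzero graded Betti
  numbers \<open>\<beta>\<^bsub>i,j\<^esub>(I) = dim\<^sub>k Tor\<^sub>i(I, k)\<^sub>j\<close>.\<close>

definition regularity :: "('n::finite, 'k::field) mpol set \<Rightarrow> ereal" where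
  "regularity I = Sup {ereal (of_int (j - int i)) | i j. Tor_nonzero I i j}"

text \<open>The supremum of a set of integers in the extended reals, except that \<open>sup \<emptyset> = 0\<close>. For
  \<open>I = S\<close> we have \<open>r = 1\<close>, \<open>f\<^sub>1 = 1\<close>, and every LCM complex is void or a full simplex, so that no
  homology is nonzero, whereas \<open>S\<close> has regularity \<open>0\<close>. For proper ideals the set in question
  is not empty.\<close>

definition sup0 :: "int set \<Rightarrow> ereal" where
  "sup0 A = (if A = {} then 0 else (SUP a\<in>A. ereal (of_int a)))"

end

theory Submission
  imports Defs
begin

text \<open>The Taylor complex on the lcms of the generators is a graded free resolution of \<open>I\<close>, and
  since any two graded free resolutions are homotopy equivalent, it computes the Tor groups. After
  tensoring with \<open>k\<close> only those entries of the differential survive for which the two lcms have the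
  same degree. So for proper \<open>I\<close> the degree \<open>j\<close> part of \<open>Tor\<^sub>i\<close> is the relative homology
  \<open>H\<^sub>i(L\<^sub>j, L\<^bsub>j-1\<^esub>)\<close>. If this is nonzero, then the long exact sequence of the pair gives
  \<open>H\<^sub>i(L\<^sub>j) \<noteq> 0\<close> or \<open>H\<^bsub>i-1\<^esub>(L\<^bsub>j-1\<^esub>) \<noteq> 0\<close>, and both have the same difference of indices. Conversely, a
  nonzero class of \<open>H\<^sub>i(L\<^sub>j)\<close> dies in some first \<open>L\<^sub>m\<close>, \<open>m > j\<close>, because \<open>L\<^sub>m\<close> is a simplex for large
  \<open>m\<close>, and the bounding chain is a nonzero class of \<open>H\<^bsub>i+1\<^esub>(L\<^sub>m, L\<^bsub>m-1\<^esub>)\<close>.\<close>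

subsection \<open>Simplicial chains as functions\<close>

text \<open>\<open>Tor\<close> is defined through an arbitrary resolution picked by a choice
  operator. Hence a resolution must be shown to exist (the Taylor complex, renumbered, provides
  one), and nonvanishing of \<open>Tor\<close> must be shown not to depend on it. Everything is
  indexed by the number of vertices: the resolution is continued by \<open>S\<close> in degree 0,
  spanned by the empty face, so that Tor_p lives on faces with p + 1 vertices. This empty face does
  not belong to the resolution of \<open>I\<close>, but it belongs to every nonvoid LCM complex. Its
  lcm degree is 0, a degree in which a proper ideal has no \<open>Tor\<close>; only
  \<open>I = S\<close> needs separate treatment. The converse direction yields an inequality, not an
  equality: a class of H_i(L_j) that dies in L_m leads to the difference m - (i + 1) \<ge> j - i,
  which is enough for suprema. Chains are plain functions, and \<open>bd\<close> gives the boundary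
  coefficient by coefficient, the value at \<open>G\<close> collecting the cofaces of
  \<open>G\<close>. Supports are side conditions, so absolute chains, relative chains and the
  multigraded parts of the Taylor complex all share this operator.\<close>

definition bd :: "nat set \<Rightarrow> (nat set \<Rightarrow> 'k::comm_ring_1) \<Rightarrow> nat set \<Rightarrow> 'k" where
  "bd V c G = (\<Sum>v\<in>V - G. (-1) ^ card {w\<in>G. w < v} * c (insert v G))"

lemma bd_0 [simp]: "bd V (\<lambda>_. 0) = (\<lambda>_. 0)"
  by (simp add: bd_def fun_eq_iff)

lemma bd_add: "bd V (\<lambda>F. c F + d F) G = bd V c G + bd V d G"
  by (simp add: bd_def sum.distrib algebra_simps)

lemma bd_diff: "bd V (\<lambda>F. c F - d F) G = bd V c G - bd V d G"
  by (simp add: bd_def sum_subtractf algebra_simps)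

lemma bd_nonzeroD:
  assumes "bd V c G \<noteq> 0"
  obtains v where "v \<in> V" "v \<notin> G" "c (insert v G) \<noteq> 0"
proof -
  from assms obtain v where "v \<in> V - G" "(-1) ^ card {w\<in>G. w < v} * c (insert v G) \<noteq> 0"
    unfolding bd_def by (meson sum.not_neutral_contains_not_neutral)
  thus thesis by (intro that[of v]) auto
qed

text \<open>Cancelling the terms in pairs works in characteristic 2 as well, where comparing the sum
  with its own negative would prove nothing.\<close>

lemma sum_antisym_eq_0:
  fixes t :: "'a \<Rightarrow> 'a \<Rightarrow> 'k::comm_ring_1"
  assumes "finite A" and "\<And>v w. v \<in> A \<Longrightarrow> w \<in> A \<Longrightarrow> v \<noteq> w \<Longrightarrow> t v w = - t w v"
  shows "(\<Sum>v\<in>A. \<Sum>w\<in>A - {v}. t v w) = 0"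
  using assms
proof (induction A rule: finite_induct)
  case (insert x A)
  have 1: "(\<Sum>w\<in>insert x A - {v}. t v w) = t v x + (\<Sum>w\<in>A - {v}. t v w)" if "v \<in> A" for v
  proof -
    have "insert x A - {v} = insert x (A - {v})" using insert(2) that by auto
    thus ?thesis using insert(1,2) by simp
  qed
  have 2: "insert x A - {x} = A" using insert(2) by auto
  have 3: "(\<Sum>v\<in>A. \<Sum>w\<in>A - {v}. t v w) = 0"
    by (rule insert.IH, rule insert.prems) auto
  have "(\<Sum>w\<in>A. t x w) = (\<Sum>w\<in>A. - t w x)"
    using insert(2) by (intro sum.cong[OF refl] insert.prems) auto
  thus ?case using insert(1,2) by (simp add: 1 2 3 sum.distrib sum_negf)
qed simp

lemma bd_bd:
  assumes "finite V" "finite G"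
  shows "bd V (bd V c) G = 0"
proof -
  define s where "s G v = (-1 :: 'a) ^ card {w\<in>G. w < v}" for G :: "nat set" and v
  define t where "t v w = s G v * s (insert v G) w * c (insert v (insert w G))" for v w
  have "bd V (bd V c) G = (\<Sum>v\<in>V - G. \<Sum>w\<in>V - insert v G. t v w)"
    unfolding bd_def t_def s_def sum_distrib_left by (simp add: insert_commute mult.assoc)
  also have "\<dots> = (\<Sum>v\<in>V - G. \<Sum>w\<in>V - G - {v}. t v w)"
    by (intro sum.cong) auto
  also have "\<dots> = 0"
  proof (rule sum_antisym_eq_0)
    \<comment> \<open>Adding \<open>v\<close> moves the position of \<open>w\<close> up by one
      exactly if \<open>v < w\<close>. Of the two orders of adding \<open>v\<close> and
      \<open>w\<close>, just one therefore picks up a sign.\<close>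
    have s: "s (insert v G) w = (if v < w then - s G w else s G w)" if "v \<notin> G" for v w
    proof -
      have "{u \<in> insert v G. u < w} = (if v < w then insert v {u\<in>G. u < w} else {u\<in>G. u < w})"
        by auto
      thus ?thesis using assms that by (simp add: s_def)
    qed
    show "t v w = - t w v" if "v \<in> V - G" "w \<in> V - G" "v \<noteq> w" for v w
      using that by (auto simp: t_def s insert_commute)
  qed (use assms in simp)
  finally show ?thesis .
qed

text \<open>For \<open>q = 0\<close> the chain is a multiple of the empty face, so this is
  acyclicity of the augmented complex, and a vertex to cone from must exist.\<close>

lemma simplex_acyclic:
  fixes c :: "nat set \<Rightarrow> 'k::comm_ring_1"
  assumes V: "finite V" "V \<noteq> {}"
    and supp: "\<And>F. c F \<noteq> 0 \<Longrightarrow> F \<subseteq> V \<and> card F = q"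
    and cyc: "\<And>G. bd V c G = 0"
  obtains w where "\<And>F. w F \<noteq> 0 \<Longrightarrow> F \<subseteq> V \<and> card F = Suc q" "bd V w = c"
proof
  \<comment> \<open>Coning from the smallest vertex makes the sign of the cone operator trivial.\<close>
  define v0 where "v0 = Min V"
  have v0: "v0 \<in> V" "\<And>v. v \<in> V \<Longrightarrow> v0 \<le> v" using V by (simp_all add: v0_def)
  define w where "w F = (if v0 \<in> F then c (F - {v0}) else 0)" for F
  show "F \<subseteq> V \<and> card F = Suc q" if "w F \<noteq> 0" for F
  proof -
    have "v0 \<in> F" "c (F - {v0}) \<noteq> 0" using that by (auto simp: w_def split: if_splits)
    with supp[of "F - {v0}"] have "F \<subseteq> V" "card (F - {v0}) = q" using v0 by auto
    moreover have "finite F" using \<open>F \<subseteq> V\<close> V finite_subset by blast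
    ultimately show ?thesis using \<open>v0 \<in> F\<close> by (metis card.remove)
  qed
  show "bd V w = c"
  proof
    fix G
    show "bd V w G = c G"
    proof (cases "G \<subseteq> V")
      case False
      have "c G = 0" using False supp[of G] by auto
      have "bd V w G = 0"
      proof (rule ccontr)
        assume "bd V w G \<noteq> 0"
        then obtain v where "w (insert v G) \<noteq> 0" by (rule bd_nonzeroD)
        hence "c (insert v G - {v0}) \<noteq> 0" by (auto simp: w_def split: if_splits)
        from supp[OF this] False v0 show False by auto
      qed
      with \<open>c G = 0\<close> show ?thesis by simp
    next
      case True
      hence fin: "finite G" using V finite_subset by blast
      show ?thesis
      proof (cases "v0 \<in> G")
        case False
        have e: "{w\<in>G. w < v0} = {}" using True v0 by (force simp: not_less)
        have "bd V w G = (\<Sum>v\<in>{v0}. (-1) ^ card {w\<in>G. w < v} * w (insert v G))"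
          unfolding bd_def using V v0 False by (intro sum.mono_neutral_right) (auto simp: w_def)
        also have "(\<Sum>v\<in>{v0}. (-1) ^ card {w\<in>G. w < v} * w (insert v G)) = c G"
          using False by (simp add: w_def e)
        finally show ?thesis .
      next
        case True': True
        define H where "H = G - {v0}"
        have G: "G = insert v0 H" "v0 \<notin> H" using True' by (auto simp: H_def)
        have "finite H" "H \<subseteq> V" using fin True by (auto simp: H_def)
        have VH: "V - H = insert v0 (V - G)" using v0 G by auto
        have e: "{w\<in>H. w < v0} = {}" using \<open>H \<subseteq> V\<close> v0 by (force simp: not_less)
        \<comment> \<open>The cycle condition at \<open>H\<close> isolates \<open>c G\<close>. The
          remaining cofaces of \<open>H\<close> carry the values of the cone on the cofaces of
          \<open>G\<close>, and \<open>v0 < v\<close> gives each of them one extra sign.\<close>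
        have "bd V c H = c G + (\<Sum>v\<in>V - G. (-1) ^ card {w\<in>H. w < v} * c (insert v H))"
          unfolding bd_def VH using V True' G by (simp add: e)
        also have "(\<Sum>v\<in>V - G. (-1) ^ card {w\<in>H. w < v} * c (insert v H)) =
                   (\<Sum>v\<in>V - G. - ((-1) ^ card {w\<in>G. w < v} * w (insert v G)))"
        proof (rule sum.cong)
          fix v assume v: "v \<in> V - G"
          hence "v0 < v" using v0(2)[of v] True' by (cases "v = v0") auto
          hence "{w\<in>G. w < v} = insert v0 {w\<in>H. w < v}" using G by auto
          moreover have "insert v G - {v0} = insert v H" using v G by auto
          ultimately show "(-1) ^ card {w\<in>H. w < v} * c (insert v H) =
              - ((-1) ^ card {w\<in>G. w < v} * w (insert v G))"
            using G \<open>finite H\<close> by (simp add: w_def)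
        qed simp
        also have "\<dots> = - bd V w G" by (simp add: bd_def sum_negf)
        finally show ?thesis using cyc[of H] by simp
      qed
    qed
  qed
qed

text \<open>\<open>q\<close> is the number of vertices, so this concerns reduced homology in degree
  \<open>q - 1\<close>, and degree -1 needs no negative index.\<close>

definition hom_nz :: "'k::field itself \<Rightarrow> nat set \<Rightarrow> nat set set \<Rightarrow> nat \<Rightarrow> bool" where
  "hom_nz T V K q \<longleftrightarrow> (\<exists>z :: nat set \<Rightarrow> 'k.
     (\<forall>F. z F \<noteq> 0 \<longrightarrow> F \<in> K \<and> card F = q) \<and> (\<forall>G. bd V z G = 0) \<and>
     \<not> (\<exists>w. (\<forall>F. w F \<noteq> 0 \<longrightarrow> F \<in> K \<and> card F = Suc q) \<and> bd V w = z))"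

lemma not_hom_nzD:
  fixes z :: "nat set \<Rightarrow> 'k::field"
  assumes "\<not> hom_nz (T :: 'k itself) V K q"
    and "\<forall>F. z F \<noteq> 0 \<longrightarrow> F \<in> K \<and> card F = q" "\<forall>G. bd V z G = 0"
  shows "\<exists>w. (\<forall>F. w F \<noteq> 0 \<longrightarrow> F \<in> K \<and> card F = Suc q) \<and> bd V w = z"
  using assms unfolding hom_nz_def by blast

text \<open>Nonvanishing of the relative homology of the pair of sublevel sets \<open>\<mu> \<le> j\<close> and \<open>\<mu> \<le> j - 1\<close>
  in cardinality \<open>q\<close>; a relative chain is represented by its restriction to the faces with \<open>\<mu> F = j\<close>.\<close>

definition rel_nz :: "'k::field itself \<Rightarrow> nat set \<Rightarrow> (nat set \<Rightarrow> nat) \<Rightarrow> nat \<Rightarrow> nat \<Rightarrow> bool" where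
  "rel_nz T V \<mu> q j \<longleftrightarrow> (\<exists>z :: nat set \<Rightarrow> 'k.
     (\<forall>F. z F \<noteq> 0 \<longrightarrow> F \<subseteq> V \<and> \<mu> F = j \<and> card F = q) \<and>
     (\<forall>G. \<mu> G = j \<longrightarrow> bd V z G = 0) \<and>
     \<not> (\<exists>w. (\<forall>F. w F \<noteq> 0 \<longrightarrow> F \<subseteq> V \<and> \<mu> F = j \<and> card F = Suc q) \<and>
            (\<forall>F. \<mu> F = j \<longrightarrow> bd V w F = z F)))"

section \<open>Homology along a filtration of the simplex by a monotone function\<close>

context
  fixes V :: "nat set" and \<mu> :: "nat set \<Rightarrow> nat"
  assumes fin: "finite V" and ne: "V \<noteq> {}"
    and mono: "\<And>F G. G \<subseteq> F \<Longrightarrow> F \<subseteq> V \<Longrightarrow> \<mu> G \<le> \<mu> F"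
begin

lemma bd_support:
  assumes "\<And>F. c F \<noteq> 0 \<Longrightarrow> F \<subseteq> V \<and> \<mu> F \<le> m \<and> card F = Suc q" "bd V c G \<noteq> 0"
  shows "G \<subseteq> V \<and> \<mu> G \<le> m \<and> card G = q"
proof -
  obtain v where v: "v \<in> V" "v \<notin> G" "c (insert v G) \<noteq> 0" using assms(2) by (rule bd_nonzeroD)
  from assms(1)[OF v(3)] have 1: "insert v G \<subseteq> V" "\<mu> (insert v G) \<le> m" "card (insert v G) = Suc q"
    by auto
  have "finite G" using 1 fin finite_subset by auto
  have "\<mu> G \<le> \<mu> (insert v G)" by (rule mono) (use 1 in auto)
  hence "\<mu> G \<le> m" using 1(2) by (rule order.trans)
  thus ?thesis using 1 v \<open>finite G\<close> by auto
qed

lemma bd_bd_eq_0: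
  assumes "\<And>F. c F \<noteq> 0 \<Longrightarrow> F \<subseteq> V"
  shows "bd V (bd V c) G = 0"
proof (cases "G \<subseteq> V")
  case True
  thus ?thesis using bd_bd fin finite_subset by blast
next
  case False
  show ?thesis
  proof (rule ccontr)
    assume "bd V (bd V c) G \<noteq> 0"
    then obtain v where v: "v \<in> V" "bd V c (insert v G) \<noteq> 0" by (rule bd_nonzeroD)
    from v(2) obtain w where "c (insert w (insert v G)) \<noteq> 0" by (rule bd_nonzeroD)
    with assms False show False by blast
  qed
qed

text \<open>This is exactness of H_p(L_j) -> H_p(L_j, L_(j-1)) -> H_(p-1)(L_(j-1)) at the middle
  term, carried out on chains. The condition \<open>0 < j\<close> keeps \<open>j - 1\<close> a
  genuinely lower level.\<close>

lemma rel_nz_imp_hom_nz: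
  assumes rel: "rel_nz (T :: 'k::field itself) V \<mu> (Suc p) j" and j: "0 < j"
  shows "hom_nz T V {F. F \<subseteq> V \<and> \<mu> F \<le> j} (Suc p) \<or> hom_nz T V {F. F \<subseteq> V \<and> \<mu> F \<le> j - 1} p"
proof (rule ccontr)
  assume "\<not> ?thesis"
  hence n1: "\<not> hom_nz T V {F. F \<subseteq> V \<and> \<mu> F \<le> j} (Suc p)"
    and n2: "\<not> hom_nz T V {F. F \<subseteq> V \<and> \<mu> F \<le> j - 1} p" by auto
  from rel obtain z :: "nat set \<Rightarrow> 'k" where
    z: "\<And>F. z F \<noteq> 0 \<Longrightarrow> F \<subseteq> V \<and> \<mu> F = j \<and> card F = Suc p"
    and zc: "\<And>G. \<mu> G = j \<Longrightarrow> bd V z G = 0"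
    and zb: "\<not> (\<exists>w. (\<forall>F. w F \<noteq> 0 \<longrightarrow> F \<subseteq> V \<and> \<mu> F = j \<and> card F = Suc (Suc p)) \<and>
            (\<forall>F. \<mu> F = j \<longrightarrow> bd V w F = z F))"
    unfolding rel_nz_def by blast
  \<comment> \<open>The boundary of \<open>z\<close> represents its image under the connecting
    homomorphism: the relative cycle condition kills the coefficients of level
    \<open>j\<close>.\<close>
  have y: "G \<subseteq> V \<and> \<mu> G \<le> j - 1 \<and> card G = p" if "bd V z G \<noteq> 0" for G
    using bd_support[of z j p G] z that zc[of G] by force
  have "bd V (bd V z) G = 0" for G by (rule bd_bd_eq_0) (use z in auto)
  with y obtain u :: "nat set \<Rightarrow> 'k" where u: "\<And>F. u F \<noteq> 0 \<Longrightarrow> F \<subseteq> V \<and> \<mu> F \<le> j - 1 \<and> card F = Suc p"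
    and bu: "bd V u = bd V z"
    using not_hom_nzD[OF n2, of "bd V z"] by auto
  let ?x = "\<lambda>F. z F - u F"
  have x: "F \<subseteq> V \<and> \<mu> F \<le> j \<and> card F = Suc p" if "?x F \<noteq> 0" for F
    using z[of F] u[of F] that by (cases "z F = 0") auto
  have "bd V ?x G = 0" for G by (simp add: bd_diff bu)
  with x obtain w where w: "\<And>F. w F \<noteq> 0 \<Longrightarrow> F \<subseteq> V \<and> \<mu> F \<le> j \<and> card F = Suc (Suc p)"
    and bw: "bd V w = ?x"
    using not_hom_nzD[OF n1, of ?x] by auto
  \<comment> \<open>At level \<open>j\<close> only \<open>w1\<close> contributes to the boundary of
    \<open>w\<close>: the boundary of \<open>w2\<close> stays in lower levels, and so does
    \<open>u\<close>.\<close>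
  define w1 where "w1 F = (if \<mu> F = j then w F else 0)" for F
  define w2 where "w2 F = (if \<mu> F = j then 0 else w F)" for F
  have w12: "w = (\<lambda>F. w1 F + w2 F)" by (auto simp: w1_def w2_def)
  have "bd V w1 F = z F" if F: "\<mu> F = j" for F
  proof -
    have "F \<subseteq> V \<and> \<mu> F \<le> j - 1 \<and> card F = Suc p" if "bd V w2 F \<noteq> 0"
      using that by (rule bd_support[rotated]) (use w in \<open>force simp: w2_def split: if_splits\<close>)
    hence "bd V w2 F = 0" using F j by force
    moreover have "u F = 0" using u[of F] F j by force
    moreover have "bd V w F = bd V w1 F + bd V w2 F" by (subst w12) (rule bd_add)
    ultimately show ?thesis using bw by simp
  qed
  moreover have "F \<subseteq> V \<and> \<mu> F = j \<and> card F = Suc (Suc p)" if "w1 F \<noteq> 0" for F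
    using that w[of F] by (auto simp: w1_def split: if_splits)
  ultimately show False using zb by blast
qed

lemma hom_nz_imp_rel_nz:
  assumes "hom_nz (T :: 'k::field itself) V {F. F \<subseteq> V \<and> \<mu> F \<le> j} q"
  obtains m where "j < m" "rel_nz T V \<mu> (Suc q) m"
proof -
  from assms obtain z :: "nat set \<Rightarrow> 'k" where
    z: "\<And>F. z F \<noteq> 0 \<Longrightarrow> F \<subseteq> V \<and> \<mu> F \<le> j \<and> card F = q"
    and zc: "\<And>G. bd V z G = 0"
    and zb: "\<not> (\<exists>w. (\<forall>F. w F \<noteq> 0 \<longrightarrow> F \<subseteq> V \<and> \<mu> F \<le> j \<and> card F = Suc q) \<and> bd V w = z)"
    unfolding hom_nz_def by (auto simp: conj_assoc)
  define P where "P m \<longleftrightarrow>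
    (\<exists>w. (\<forall>F. w F \<noteq> 0 \<longrightarrow> F \<subseteq> V \<and> \<mu> F \<le> m \<and> card F = Suc q) \<and> bd V w = z)" for m
  obtain w0 where "\<And>F. w0 F \<noteq> 0 \<Longrightarrow> F \<subseteq> V \<and> card F = Suc q" "bd V w0 = z"
    by (rule simplex_acyclic[OF fin ne, of z q]) (use z zc in auto)
  hence "P (\<mu> V)" unfolding P_def using mono by (intro exI[of _ w0]) auto
  define m where "m = (LEAST m. P m)"
  have Pm: "P m" unfolding m_def using \<open>P (\<mu> V)\<close> by (rule LeastI)
  have min: "\<not> P n" if "n < m" for n using that unfolding m_def by (rule not_less_Least)
  have "\<not> P n" if "n \<le> j" for n
  proof
    assume "P n"
    then obtain w where "\<forall>F. w F \<noteq> 0 \<longrightarrow> F \<subseteq> V \<and> \<mu> F \<le> n \<and> card F = Suc q" "bd V w = z"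
      unfolding P_def by blast
    with that have "\<forall>F. w F \<noteq> 0 \<longrightarrow> F \<subseteq> V \<and> \<mu> F \<le> j \<and> card F = Suc q" by force
    with \<open>bd V w = z\<close> zb show False by blast
  qed
  with Pm have jm: "j < m" using not_less by blast
  from Pm obtain w where w: "\<And>F. w F \<noteq> 0 \<Longrightarrow> F \<subseteq> V \<and> \<mu> F \<le> m \<and> card F = Suc q"
    and bw: "bd V w = z" unfolding P_def by blast
  define w1 where "w1 F = (if \<mu> F = m then w F else 0)" for F
  define w2 where "w2 F = (if \<mu> F = m then 0 else w F)" for F
  have w12: "w = (\<lambda>F. w1 F + w2 F)" by (auto simp: w1_def w2_def)
  have w1: "F \<subseteq> V \<and> \<mu> F = m \<and> card F = Suc q" if "w1 F \<noteq> 0" for F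
    using that w[of F] by (auto simp: w1_def split: if_splits)
  have "bd V w1 G = 0" if G: "\<mu> G = m" for G
  proof -
    have "G \<subseteq> V \<and> \<mu> G \<le> m - 1 \<and> card G = q" if "bd V w2 G \<noteq> 0"
      using that by (rule bd_support[rotated]) (use w in \<open>force simp: w2_def split: if_splits\<close>)
    hence "bd V w2 G = 0" using G jm by force
    moreover have "z G = 0" using z[of G] G jm by auto
    moreover have "bd V w G = bd V w1 G + bd V w2 G" by (subst w12) (rule bd_add)
    ultimately show ?thesis using bw by simp
  qed
  \<comment> \<open>If \<open>w1\<close> were the relative boundary of \<open>x\<close>, then
    \<open>w - bd V x\<close> could replace \<open>w\<close>: its boundary is still
    \<open>z\<close>, but it lives in level \<open>m - 1\<close>, against the minimality of
    \<open>m\<close>.\<close>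
  moreover have False
    if x: "\<forall>F. x F \<noteq> 0 \<longrightarrow> F \<subseteq> V \<and> \<mu> F = m \<and> card F = Suc (Suc q)"
      and bx: "\<forall>F. \<mu> F = m \<longrightarrow> bd V x F = w1 F" for x
  proof -
    let ?u = "\<lambda>F. w F - bd V x F"
    have s: "F \<subseteq> V \<and> \<mu> F \<le> m \<and> card F = Suc q" if "bd V x F \<noteq> 0" for F
      using that by (rule bd_support[rotated]) (use x in auto)
    have "F \<subseteq> V \<and> \<mu> F \<le> m - 1 \<and> card F = Suc q" if "?u F \<noteq> 0" for F
    proof -
      have "\<mu> F \<noteq> m" using that bx by (auto simp: w1_def)
      moreover have "F \<subseteq> V \<and> \<mu> F \<le> m \<and> card F = Suc q"
        using that w[of F] s[of F] by fastforce
      ultimately show ?thesis by auto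
    qed
    moreover have "bd V (bd V x) G = 0" for G by (rule bd_bd_eq_0) (use x in auto)
    hence "bd V ?u = z" by (simp add: fun_eq_iff bd_diff bw)
    ultimately have "P (m - 1)" unfolding P_def by (intro exI[of _ ?u]) simp
    thus False using min[of "m - 1"] jm by simp
  qed
  ultimately have "rel_nz T V \<mu> (Suc q) m" unfolding rel_nz_def using w1 by blast
  thus thesis using that jm by blast
qed

end

subsection \<open>Reduced homology\<close>

text \<open>Serves simplicial homology and \<open>Tor\<close> alike, so that cosets need not be
  handled afterwards.\<close>

lemma quotient_group_nonzero_iff:
  fixes Z B :: "'a::ab_group_add set"
  assumes "0 \<in> B" "\<And>x y. x \<in> B \<Longrightarrow> y \<in> B \<Longrightarrow> x + y \<in> B" "\<And>x. x \<in> B \<Longrightarrow> - x \<in> B" "0 \<in> Z"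
  shows "quotient_group Z B \<noteq> {B} \<longleftrightarrow> (\<exists>z\<in>Z. z \<notin> B)"
proof -
  have eq: "(+) z ` B = B" if "z \<in> B" for z
  proof (intro equalityI subsetI)
    fix x assume "x \<in> B"
    have "x = z + (- z + x)" by simp
    moreover have "- z + x \<in> B" using assms(2)[OF assms(3)[OF that] \<open>x \<in> B\<close>] .
    ultimately show "x \<in> (+) z ` B" by blast
  qed (use assms that in auto)
  show ?thesis
  proof
    assume "quotient_group Z B \<noteq> {B}"
    moreover have "B \<in> quotient_group Z B"
      unfolding quotient_group_def using assms(4) eq[OF assms(1)] by (metis image_eqI)
    ultimately show "\<exists>z\<in>Z. z \<notin> B" unfolding quotient_group_def using eq by fastforce
  next
    assume "\<exists>z\<in>Z. z \<notin> B"
    then obtain z where z: "z \<in> Z" "z \<notin> B" by blast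
    have "z \<in> (+) z ` B" using assms(1) by (metis add.right_neutral image_eqI)
    with z have "(+) z ` B \<noteq> B" by blast
    moreover have "(+) z ` B \<in> quotient_group Z B" unfolding quotient_group_def using z by blast
    ultimately show "quotient_group Z B \<noteq> {B}" by auto
  qed
qed

text \<open>Exchanging the sums passes from faces to cofaces: removing a vertex \<open>v\<close> of
  \<open>F\<close> gives \<open>G\<close> exactly if \<open>v\<close> lies outside \<open>G\<close>
  and \<open>F = insert v G\<close>.\<close>

lemma lookup_bdry:
  assumes V: "finite V" and c: "Poly_Mapping.keys c \<subseteq> Pow V"
  shows "Poly_Mapping.lookup (bdry c) G = bd V (Poly_Mapping.lookup c) G"
proof -
  let ?K = "Poly_Mapping.keys c" and ?c = "Poly_Mapping.lookup c"
  have "Poly_Mapping.lookup (bdry c) G =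
      (\<Sum>F\<in>?K. \<Sum>v\<in>F. if F - {v} = G then (-1) ^ card {w\<in>F. w < v} * ?c F else 0)"
    unfolding bdry_def by (simp add: lookup_sum lookup_single when_def)
  also have "\<dots> = (\<Sum>F\<in>?K. \<Sum>v\<in>V. if v \<in> F \<and> F - {v} = G then (-1) ^ card {w\<in>F. w < v} * ?c F else 0)"
    using c V by (intro sum.cong[OF refl] sum.mono_neutral_cong_left) auto
  also have "\<dots> = (\<Sum>v\<in>V. \<Sum>F\<in>?K. if v \<in> F \<and> F - {v} = G then (-1) ^ card {w\<in>F. w < v} * ?c F else 0)"
    by (rule sum.swap)
  also have "\<dots> = (\<Sum>v\<in>V. if v \<in> G then 0 else (-1) ^ card {w\<in>G. w < v} * ?c (insert v G))"
  proof (rule sum.cong)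
    fix v assume v: "v \<in> V"
    show "(\<Sum>F\<in>?K. if v \<in> F \<and> F - {v} = G then (-1) ^ card {w\<in>F. w < v} * ?c F else 0) =
          (if v \<in> G then 0 else (-1) ^ card {w\<in>G. w < v} * ?c (insert v G))"
    proof (cases "v \<in> G")
      case False
      have eq: "v \<in> F \<and> F - {v} = G \<longleftrightarrow> F = insert v G" for F using False by auto
      have "{w \<in> insert v G. w < v} = {w\<in>G. w < v}" by auto
      thus ?thesis using False by (auto simp: eq in_keys_iff)
    qed (auto intro!: sum.neutral)
  qed simp
  also have "\<dots> = bd V ?c G"
    unfolding bd_def using V by (intro sum.mono_neutral_cong_right) auto
  finally show ?thesis .
qed

text \<open>The index set \<open>keys\<close> changes under cancellation, so additivity is read off
  from the coefficients. Finiteness of the faces provides a common finite vertex set.\<close>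

lemma bdry_add:
  fixes c d :: "nat set \<Rightarrow>\<^sub>0 'k::field"
  assumes "\<forall>F\<in>Poly_Mapping.keys c. finite F" "\<forall>F\<in>Poly_Mapping.keys d. finite F"
  shows "bdry (c + d) = bdry c + bdry d"
proof -
  define V where "V = \<Union>(Poly_Mapping.keys c \<union> Poly_Mapping.keys d)"
  have V: "finite V" "Poly_Mapping.keys c \<subseteq> Pow V" "Poly_Mapping.keys d \<subseteq> Pow V"
    using assms by (auto simp: V_def)
  hence "Poly_Mapping.keys (c + d) \<subseteq> Pow V" using Poly_Mapping.keys_add[of c d] by blast
  moreover have "Poly_Mapping.lookup (c + d) = (\<lambda>F. Poly_Mapping.lookup c F + Poly_Mapping.lookup d F)"
    by (simp add: fun_eq_iff lookup_add)
  ultimately show ?thesis using V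
    by (intro poly_mapping_eqI) (simp add: lookup_bdry[of V] lookup_add bd_add)
qed

lemma bdry_uminus: "bdry (- c) = - bdry (c :: nat set \<Rightarrow>\<^sub>0 'k::field)"
  by (simp add: bdry_def sum_negf single_uminus)

lemma reduced_homology_nonzero_iff:
  assumes V: "finite V" and K: "K \<subseteq> Pow V"
  shows "reduced_homology_nonzero (T :: 'k::field itself) K i \<longleftrightarrow>
    (\<exists>q. i = int q - 1 \<and> hom_nz T V K q)"
proof -
  have fK: "finite F" if "F \<in> K" for F using that K V finite_subset[of F V] by auto
  have finK: "finite K" using K V finite_subset[of K "Pow V"] by simp
  have "reduced_homology_nonzero T K i \<longleftrightarrow> (\<exists>z\<in>cycles K i. (z :: nat set \<Rightarrow>\<^sub>0 'k) \<notin> boundaries K i)"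
    unfolding reduced_homology_nonzero_def reduced_homology_def
  proof (rule quotient_group_nonzero_iff)
    show "0 \<in> (boundaries K i :: (nat set \<Rightarrow>\<^sub>0 'k) set)" "0 \<in> (cycles K i :: (nat set \<Rightarrow>\<^sub>0 'k) set)"
      by (auto simp: boundaries_def cycles_def chains_def bdry_def intro!: image_eqI[of _ _ 0])
    fix x y :: "nat set \<Rightarrow>\<^sub>0 'k" assume "x \<in> boundaries K i" "y \<in> boundaries K i"
    then obtain c d where c: "c \<in> chains K (i+1)" "x = bdry c" and d: "d \<in> chains K (i+1)" "y = bdry d"
      by (auto simp: boundaries_def)
    have "c + d \<in> chains K (i+1)" using c d Poly_Mapping.keys_add[of c d] by (auto simp: chains_def)
    moreover have "bdry (c + d) = x + y" using c d by (auto simp: chains_def bdry_add)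
    ultimately show "x + y \<in> boundaries K i" by (auto simp: boundaries_def intro!: image_eqI)
  next
    fix x :: "nat set \<Rightarrow>\<^sub>0 'k" assume "x \<in> boundaries K i"
    then obtain c where c: "c \<in> chains K (i+1)" "x = bdry c" by (auto simp: boundaries_def)
    hence "- c \<in> chains K (i+1)" "bdry (- c) = - x" by (auto simp: chains_def bdry_uminus)
    thus "- x \<in> boundaries K i" by (auto simp: boundaries_def intro!: image_eqI)
  qed
  also have "\<dots> \<longleftrightarrow> (\<exists>q. i = int q - 1 \<and> hom_nz T V K q)"
  proof
    assume "\<exists>z\<in>cycles K i. (z :: nat set \<Rightarrow>\<^sub>0 'k) \<notin> boundaries K i"
    then obtain z :: "nat set \<Rightarrow>\<^sub>0 'k" where z: "z \<in> chains K i" "bdry z = 0" "z \<notin> boundaries K i"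
      by (auto simp: cycles_def)
    \<comment> \<open>Zero is a boundary, so \<open>z\<close> has a face in its support, and the
      cardinality of that face provides \<open>q\<close>. In particular there is no homology below
      degree -1.\<close>
    have "0 \<in> chains K (i + 1)" "bdry 0 = (0 :: nat set \<Rightarrow>\<^sub>0 'k)" by (simp_all add: chains_def bdry_def)
    hence "z \<noteq> 0" using z unfolding boundaries_def by (metis image_eqI)
    then obtain F where "F \<in> Poly_Mapping.keys z" by (metis all_not_in_conv keys_eq_empty)
    hence i: "i = int (card F) - 1" using z by (auto simp: chains_def)
    have "hom_nz T V K (card F)" unfolding hom_nz_def
    proof (intro exI[of _ "Poly_Mapping.lookup z"] conjI allI notI impI)
      show "F' \<in> K" "card F' = card F" if "Poly_Mapping.lookup z F' \<noteq> 0" for F'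
        using z(1) that i by (auto simp: chains_def in_keys_iff)
      have "Poly_Mapping.keys z \<subseteq> Pow V" using z(1) K by (auto simp: chains_def)
      thus "bd V (Poly_Mapping.lookup z) G = 0" for G
        using z(2) V by (simp add: lookup_bdry[symmetric])
      assume "\<exists>w. (\<forall>F'. w F' \<noteq> 0 \<longrightarrow> F' \<in> K \<and> card F' = Suc (card F)) \<and> bd V w = Poly_Mapping.lookup z"
      then obtain w where w: "\<And>F'. w F' \<noteq> 0 \<Longrightarrow> F' \<in> K \<and> card F' = Suc (card F)"
        and bw: "bd V w = Poly_Mapping.lookup z" by blast
      have "finite {F. w F \<noteq> 0}" by (rule finite_subset[OF _ finK]) (use w in auto)
      hence l: "Poly_Mapping.lookup (Abs_poly_mapping w) = w" by simp
      have ch: "Abs_poly_mapping w \<in> chains K (i + 1)"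
        using w i fK by (auto simp: chains_def in_keys_iff l)
      hence "Poly_Mapping.keys (Abs_poly_mapping w) \<subseteq> Pow V" using K by (auto simp: chains_def)
      hence "bdry (Abs_poly_mapping w) = z"
        using V by (intro poly_mapping_eqI) (simp add: lookup_bdry[of V] l bw)
      with ch z(3) show False by (auto simp: boundaries_def)
    qed
    with i show "\<exists>q. i = int q - 1 \<and> hom_nz T V K q" by blast
  next
    assume "\<exists>q. i = int q - 1 \<and> hom_nz T V K q"
    then obtain q and z :: "nat set \<Rightarrow> 'k" where i: "i = int q - 1"
      and z: "\<And>F. z F \<noteq> 0 \<Longrightarrow> F \<in> K \<and> card F = q" and zc: "\<And>G. bd V z G = 0"
      and zb: "\<not> (\<exists>w. (\<forall>F. w F \<noteq> 0 \<longrightarrow> F \<in> K \<and> card F = Suc q) \<and> bd V w = z)"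
      unfolding hom_nz_def by blast
    have "finite {F. z F \<noteq> 0}" by (rule finite_subset[OF _ finK]) (use z in auto)
    hence l: "Poly_Mapping.lookup (Abs_poly_mapping z) = z" by simp
    have ch: "Abs_poly_mapping z \<in> chains K i"
      using z i fK by (auto simp: chains_def in_keys_iff l)
    hence "Poly_Mapping.keys (Abs_poly_mapping z) \<subseteq> Pow V" using K by (auto simp: chains_def)
    hence "bdry (Abs_poly_mapping z) = 0"
      using V by (intro poly_mapping_eqI) (simp add: lookup_bdry[of V] l zc)
    with ch have "Abs_poly_mapping z \<in> cycles K i" by (simp add: cycles_def)
    moreover have "Abs_poly_mapping z \<notin> boundaries K i"
    proof
      assume "Abs_poly_mapping z \<in> boundaries K i"
      then obtain c where c: "c \<in> chains K (i+1)" "Abs_poly_mapping z = bdry c"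
        by (auto simp: boundaries_def)
      hence "Poly_Mapping.keys c \<subseteq> Pow V" using K by (auto simp: chains_def)
      hence "bd V (Poly_Mapping.lookup c) = z"
        using V c(2) l by (metis lookup_bdry ext)
      moreover have "F \<in> K \<and> card F = Suc q" if "Poly_Mapping.lookup c F \<noteq> 0" for F
      proof -
        have "F \<in> K" "int (card F) = i + 1 + 1" using c(1) that by (simp_all add: chains_def in_keys_iff)
        thus ?thesis using i by simp
      qed
      ultimately show False using zb by blast
    qed
    ultimately show "\<exists>z\<in>cycles K i. (z :: nat set \<Rightarrow>\<^sub>0 'k) \<notin> boundaries K i" by blast
  qed
  finally show ?thesis .
qed

subsection \<open>Homogeneous parts and constant coefficients\<close>

lemma mon_deg_add: "mon_deg (a + b) = mon_deg a + mon_deg b"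
  by (simp add: mon_deg_def lookup_add sum.distrib)

lemma mon_deg_0 [simp]: "mon_deg 0 = 0"
  by (simp add: mon_deg_def)

lemma mon_deg_eq_0_iff: "mon_deg m = 0 \<longleftrightarrow> m = 0"
  by (auto simp: mon_deg_def poly_mapping_eq_iff fun_eq_iff)

definition hpart :: "int \<Rightarrow> ('n::finite, 'k::field) mpol \<Rightarrow> ('n, 'k) mpol" where
  "hpart d p = Abs_poly_mapping (\<lambda>m. if int (mon_deg m) = d then Poly_Mapping.lookup p m else 0)"

lemma lookup_hpart:
  "Poly_Mapping.lookup (hpart d p) m = (if int (mon_deg m) = d then Poly_Mapping.lookup p m else 0)"
proof -
  have "{m. (if int (mon_deg m) = d then Poly_Mapping.lookup p m else 0) \<noteq> 0} \<subseteq> Poly_Mapping.keys p"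
    by (auto simp: in_keys_iff)
  hence "finite {m. (if int (mon_deg m) = d then Poly_Mapping.lookup p m else 0) \<noteq> 0}"
    using finite_subset finite_keys by blast
  thus ?thesis unfolding hpart_def by (simp only: lookup_Abs_poly_mapping)
qed

text \<open>With homogeneity as a fixed-point equation, closure under sums, differences and products
  follows from the rules for \<open>hpart\<close>.\<close>

lemma homogeneous_iff_hpart: "homogeneous d p \<longleftrightarrow> hpart d p = p"
  by (auto simp: homogeneous_def poly_mapping_eq_iff fun_eq_iff lookup_hpart in_keys_iff split: if_splits)

lemma homogeneous_hpart: "homogeneous d (hpart d p)"
  by (auto simp: homogeneous_def in_keys_iff lookup_hpart split: if_splits)

lemma hpart_sum: "hpart d (\<Sum>x\<in>A. p x) = (\<Sum>x\<in>A. hpart d (p x))"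
  by (rule poly_mapping_eqI) (simp add: lookup_hpart lookup_sum)

lemma hpart_diff: "hpart d (p - q) = hpart d p - hpart d q"
  by (rule poly_mapping_eqI) (simp add: lookup_hpart lookup_minus)

text \<open>Every term of the convolution takes a monomial of degree \<open>d\<close> from
  \<open>p\<close>, so multiplication by \<open>p\<close> shifts all components of \<open>q\<close>
  by \<open>d\<close>.\<close>

lemma homogeneous_mult_hpart:
  assumes "homogeneous d p"
  shows "hpart (d + e) (p * q) = p * hpart e q"
proof (rule poly_mapping_eqI)
  fix k
  have deg: "int (mon_deg l) = d" if "Poly_Mapping.lookup p l \<noteq> 0" for l
    using assms that by (simp add: homogeneous_def in_keys_iff)
  show "Poly_Mapping.lookup (hpart (d + e) (p * q)) k = Poly_Mapping.lookup (p * hpart e q) k"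
  proof (cases "int (mon_deg k) = d + e")
    case True
    have "Poly_Mapping.lookup p l * (\<Sum>m. Poly_Mapping.lookup q m when k = l + m) =
          Poly_Mapping.lookup p l * (\<Sum>m. Poly_Mapping.lookup (hpart e q) m when k = l + m)" for l
    proof (cases "Poly_Mapping.lookup p l = 0")
      case False
      have "(Poly_Mapping.lookup q m when k = l + m) = (Poly_Mapping.lookup (hpart e q) m when k = l + m)" for m
        using True deg[OF False] by (auto simp: when_def lookup_hpart mon_deg_add)
      thus ?thesis by simp
    qed simp
    hence "(\<Sum>l. Poly_Mapping.lookup p l * (\<Sum>m. Poly_Mapping.lookup q m when k = l + m)) =
        (\<Sum>l. Poly_Mapping.lookup p l * (\<Sum>m. Poly_Mapping.lookup (hpart e q) m when k = l + m))"
      by (rule Sum_any.cong)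
    thus ?thesis using True by (simp add: lookup_hpart[of "d + e"] lookup_mult)
  next
    case F: False
    have "Poly_Mapping.lookup p l * (\<Sum>m. Poly_Mapping.lookup (hpart e q) m when k = l + m) = 0" for l
    proof (cases "Poly_Mapping.lookup p l = 0")
      case False
      have "(Poly_Mapping.lookup (hpart e q) m when k = l + m) = 0" for m
        using F deg[OF False] by (auto simp: when_def lookup_hpart mon_deg_add)
      thus ?thesis by simp
    qed simp
    hence "(\<lambda>l. Poly_Mapping.lookup p l * (\<Sum>m. Poly_Mapping.lookup (hpart e q) m when k = l + m)) = (\<lambda>_. 0)"
      by (rule ext)
    hence "Poly_Mapping.lookup (p * hpart e q) k = 0"
      unfolding lookup_mult by (elim ssubst) (simp add: Sum_any.expand_set)
    thus ?thesis using F by (simp add: lookup_hpart)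
  qed
qed

lemma homogeneous_mult: "homogeneous d p \<Longrightarrow> homogeneous e q \<Longrightarrow> homogeneous (d + e) (p * q)"
  using homogeneous_mult_hpart[of d p e q] by (simp add: homogeneous_iff_hpart)

lemma homogeneous_sum: "(\<And>x. x \<in> A \<Longrightarrow> homogeneous d (p x)) \<Longrightarrow> homogeneous d (\<Sum>x\<in>A. p x)"
  by (simp add: homogeneous_iff_hpart hpart_sum)

lemma homogeneous_diff: "homogeneous d p \<Longrightarrow> homogeneous d q \<Longrightarrow> homogeneous d (p - q)"
  by (simp add: homogeneous_iff_hpart hpart_diff)

lemma homogeneous_0 [simp]: "homogeneous d 0"
  by (simp add: homogeneous_def)

lemma homogeneous_1 [simp]: "homogeneous 0 1"
  by (auto simp: homogeneous_def in_keys_iff lookup_one when_def)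

text \<open>The monomial 1 has only the trivial factorization, so taking constant coefficients is
  multiplicative. This is the map from \<open>S\<close> to \<open>k\<close> along which resolutions
  are tensored.\<close>

lemma lookup_mult_0:
  "Poly_Mapping.lookup (p * q) 0 = Poly_Mapping.lookup p 0 * Poly_Mapping.lookup (q :: ('n::finite, 'k::field) mpol) 0"
proof -
  have eq: "(0 :: 'n mon) = l + m \<longleftrightarrow> l = 0 \<and> m = 0" for l m :: "'n mon"
    by (auto simp: poly_mapping_eq_iff fun_eq_iff lookup_add)
  have "(\<Sum>m. Poly_Mapping.lookup q m when 0 = l + m) = (Poly_Mapping.lookup q 0 when l = 0)" for l
    by (cases "l = 0") (simp_all add: eq)
  thus ?thesis by (simp add: lookup_mult mult_when)
qed

lemma lookup_0_homogeneous_nonzeroD: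
  "homogeneous d p \<Longrightarrow> Poly_Mapping.lookup p 0 \<noteq> 0 \<Longrightarrow> d = 0"
  unfolding homogeneous_def by (metis in_keys_iff mon_deg_0 of_nat_0)

subsection \<open>Comparison of graded free resolutions\<close>

text \<open>Index sets instead of sizes let faces and numbers serve as bases. Column
  \<open>d\<close> of a matrix product \<open>A E\<close> is
  \<open>mv C A (\<lambda>c. E c d)\<close>; matrix identities below are stated column by column in
  this form.\<close>

definition mv :: "'c set \<Rightarrow> ('a \<Rightarrow> 'c \<Rightarrow> 'r::comm_ring_1) \<Rightarrow> ('c \<Rightarrow> 'r) \<Rightarrow> 'a \<Rightarrow> 'r" where
  "mv C A v a = (\<Sum>c\<in>C. A a c * v c)"

lemma mv_assoc:
  "mv C A (mv D E v) a = mv D (\<lambda>a d. mv C A (\<lambda>c. E c d) a) v a"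
  unfolding mv_def sum_distrib_left sum_distrib_right by (subst sum.swap) (simp add: mult.assoc)

lemma mv_cong:
  "(\<And>c. c \<in> C \<Longrightarrow> A a c = A' a' c) \<Longrightarrow> (\<And>c. c \<in> C \<Longrightarrow> v c = v' c) \<Longrightarrow> mv C A v a = mv C A' v' a'"
  unfolding mv_def by (rule sum.cong) auto

lemma mv_eq_0: "(\<And>c. c \<in> C \<Longrightarrow> v c = 0) \<Longrightarrow> mv C A v a = 0"
  by (simp add: mv_def)

lemma mv_diff: "mv C A (\<lambda>c. v c - w c) a = mv C A v a - mv C A w a"
  by (simp add: mv_def algebra_simps sum_subtractf)

lemma mv_diff_left: "mv C (\<lambda>a c. A a c - A' a c) v a = mv C A v a - mv C A' v a"
  by (simp add: mv_def algebra_simps sum_subtractf)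

lemma mv_id: "finite C \<Longrightarrow> a \<in> C \<Longrightarrow> mv C (\<lambda>a c. if a = c then 1 else 0) v a = v a"
  by (simp add: mv_def if_distrib[of "\<lambda>x. x * _"] cong: if_cong)

lemma mv_unit: "finite C \<Longrightarrow> b \<in> C \<Longrightarrow> mv C A (\<lambda>c. if c = b then 1 else 0) a = A a b"
  by (simp add: mv_def if_distrib[of "\<lambda>x. _ * x"] cong: if_cong)

text \<open>The matrix of the same map after tensoring with \<open>k\<close>.\<close>

abbreviation cc :: "('a \<Rightarrow> 'b \<Rightarrow> ('n::finite, 'k::field) mpol) \<Rightarrow> 'a \<Rightarrow> 'b \<Rightarrow> 'k" where
  "cc A \<equiv> (\<lambda>a b. Poly_Mapping.lookup (A a b) 0)"

lemma lookup_mv_0: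
  "Poly_Mapping.lookup (mv C A v a) 0 = mv C (cc A) (\<lambda>c. Poly_Mapping.lookup (v c) 0) a"
  by (simp add: mv_def lookup_sum lookup_mult_0)

lemma homogeneous_mv:
  assumes "\<And>c. c \<in> C \<Longrightarrow> homogeneous (h c - e) (A a c)" "\<And>c. c \<in> C \<Longrightarrow> homogeneous (g - h c) (v c)"
  shows "homogeneous (g - e) (mv C A v a)"
  unfolding mv_def
proof (rule homogeneous_sum)
  fix c assume "c \<in> C"
  from homogeneous_mult[OF assms(1)[OF this] assms(2)[OF this]]
  show "homogeneous (g - e) (A a c * v c)" by simp
qed

text \<open>A homogeneous entry has a constant coefficient only in degree 0, that is, between basis
  elements of equal degree. Hence maps of degree 0 respect the internal degree after tensoring with
  \<open>k\<close>.\<close>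

lemma degree_mv_nonzero:
  assumes "mv C (cc A) v a \<noteq> 0" "\<And>c. c \<in> C \<Longrightarrow> v c \<noteq> 0 \<Longrightarrow> h c = j"
    and "\<And>c. c \<in> C \<Longrightarrow> homogeneous (h c - e) (A a c)"
  shows "e = j"
proof -
  from assms(1) obtain c where c: "c \<in> C" "cc A a c * v c \<noteq> 0"
    unfolding mv_def by (meson sum.not_neutral_contains_not_neutral)
  hence "h c = j" "Poly_Mapping.lookup (A a c) 0 \<noteq> 0" using assms(2)[of c] by auto
  with lookup_0_homogeneous_nonzeroD[OF assms(3)[OF c(1)]] show ?thesis by simp
qed

text \<open>Exactness yields solutions without any control of degrees. Since \<open>D\<close> and
  \<open>M\<close> are homogeneous, each coordinate of a solution may be replaced by its component
  of the degree required for a graded map.\<close>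

lemma homogeneous_lift:
  fixes D :: "'a \<Rightarrow> 'c \<Rightarrow> ('n::finite, 'k::field) mpol"
  assumes D: "\<And>a c. a \<in> A \<Longrightarrow> c \<in> C \<Longrightarrow> homogeneous (h c - e a) (D a c)"
    and M: "\<And>a b. a \<in> A \<Longrightarrow> b \<in> B \<Longrightarrow> homogeneous (g b - e a) (M a b)"
    and ex: "\<And>b. b \<in> B \<Longrightarrow> \<exists>w. \<forall>a\<in>A. M a b = mv C D w a"
  obtains N where "\<And>c b. c \<in> C \<Longrightarrow> b \<in> B \<Longrightarrow> homogeneous (g b - h c) (N c b)"
    and "\<And>a b. a \<in> A \<Longrightarrow> b \<in> B \<Longrightarrow> mv C D (\<lambda>c. N c b) a = M a b"
proof
  define w where "w b = (SOME w. \<forall>a\<in>A. M a b = mv C D w a)" for b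
  have w: "M a b = mv C D (w b) a" if "b \<in> B" "a \<in> A" for a b
    using someI_ex[OF ex[OF that(1)]] that(2) unfolding w_def by blast
  show "homogeneous (g b - h c) (hpart (g b - h c) (w b c))" for b c by (rule homogeneous_hpart)
  show "mv C D (\<lambda>c. hpart (g b - h c) (w b c)) a = M a b" if ab: "a \<in> A" "b \<in> B" for a b
  proof -
    have "M a b = hpart (g b - e a) (M a b)" using M[OF ab] by (simp add: homogeneous_iff_hpart)
    also have "\<dots> = hpart (g b - e a) (mv C D (w b) a)" using w[OF ab(2,1)] by simp
    also have "\<dots> = (\<Sum>c\<in>C. hpart (g b - e a) (D a c * w b c))" by (simp add: mv_def hpart_sum)
    also have "\<dots> = (\<Sum>c\<in>C. D a c * hpart (g b - h c) (w b c))"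
    proof (rule sum.cong)
      fix c assume "c \<in> C"
      from homogeneous_mult_hpart[OF D[OF ab(1) this], of "g b - h c" "w b c"]
      show "hpart (g b - e a) (D a c * w b c) = D a c * hpart (g b - h c) (w b c)" by simp
    qed simp
    finally show ?thesis by (simp add: mv_def)
  qed
qed

text \<open>A graded free resolution of a homogeneous ideal \<open>I\<close> is stored as an exact complex
  \<open>\<dots> \<rightarrow> X\<^sub>2 \<rightarrow> X\<^sub>1 \<rightarrow> X\<^sub>0 = S\<close> (so that \<open>X\<^sub>1\<close> maps onto \<open>I\<close>) in which \<open>X\<^sub>i\<close> has the basis \<open>B i\<close>;
  homological degrees are shifted by one against the resolution.\<close>

locale free_res =
  fixes B :: "nat \<Rightarrow> 'b set" and g :: "nat \<Rightarrow> 'b \<Rightarrow> int"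
    and D :: "nat \<Rightarrow> 'b \<Rightarrow> 'b \<Rightarrow> ('n::finite, 'k::field) mpol" and bot :: 'b
  assumes finite_B: "finite (B i)"
    and hom_D: "a \<in> B i \<Longrightarrow> b \<in> B (Suc i) \<Longrightarrow> homogeneous (g (Suc i) b - g i a) (D i a b)"
    and DD: "a \<in> B i \<Longrightarrow> c \<in> B (Suc (Suc i)) \<Longrightarrow> mv (B (Suc i)) (D i) (\<lambda>b. D (Suc i) b c) a = 0"
    and exact: "(\<And>a. a \<in> B i \<Longrightarrow> mv (B (Suc i)) (D i) v a = 0) \<Longrightarrow>
      \<exists>w. \<forall>b\<in>B (Suc i). v b = mv (B (Suc (Suc i))) (D (Suc i)) w b"
    and B_0: "B 0 = {bot}" and g_bot: "g 0 bot = 0"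
begin

definition image :: "('n, 'k) mpol set" where
  "image = range (\<lambda>v. mv (B 1) (D 0) v bot)"

text \<open>\<open>X\<^sub>0\<close> is not part of the resolution, so there is no cycle condition for \<open>p = 0\<close>.\<close>

definition tor_nz :: "nat \<Rightarrow> int \<Rightarrow> bool" where
  "tor_nz p j \<longleftrightarrow> (\<exists>z.
     (\<forall>b\<in>B (Suc p). z b \<noteq> 0 \<longrightarrow> g (Suc p) b = j) \<and>
     (p \<noteq> 0 \<longrightarrow> (\<forall>a\<in>B p. mv (B (Suc p)) (cc (D p)) z a = 0)) \<and>
     \<not> (\<exists>w. (\<forall>c\<in>B (Suc (Suc p)). w c \<noteq> 0 \<longrightarrow> g (Suc (Suc p)) c = j) \<and>
            (\<forall>b\<in>B (Suc p). z b = mv (B (Suc (Suc p))) (cc (D (Suc p))) w b)))"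

lemma not_tor_nzD:
  assumes "\<not> tor_nz p j"
    and "\<forall>b\<in>B (Suc p). z b \<noteq> 0 \<longrightarrow> g (Suc p) b = j"
    and "p \<noteq> 0 \<longrightarrow> (\<forall>a\<in>B p. mv (B (Suc p)) (cc (D p)) z a = 0)"
  shows "\<exists>w. (\<forall>c\<in>B (Suc (Suc p)). w c \<noteq> 0 \<longrightarrow> g (Suc (Suc p)) c = j) \<and>
            (\<forall>b\<in>B (Suc p). z b = mv (B (Suc (Suc p))) (cc (D (Suc p))) w b)"
proof (rule ccontr)
  assume "\<not> ?thesis"
  with assms(2,3) have "tor_nz p j" unfolding tor_nz_def by (intro exI[of _ z] conjI)
  with assms(1) show False ..
qed

text \<open>The columns of \<open>X - s D\<close> are cycles, so exactness lifts them degree by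
  degree; the result is the homotopy \<open>X = D s + s D\<close>. The start \<open>s 0 = 0\<close>
  is possible because \<open>X\<close> vanishes on \<open>S\<close>, and it later covers
  \<open>p = 0\<close>, where \<open>Tor\<close> has no cycle condition.\<close>

lemma null_homotopy:
  assumes hom: "\<And>i a b. a \<in> B i \<Longrightarrow> b \<in> B i \<Longrightarrow> homogeneous (g i b - g i a) (X i a b)"
    and comm: "\<And>i a b. a \<in> B i \<Longrightarrow> b \<in> B (Suc i) \<Longrightarrow>
      mv (B (Suc i)) (D i) (\<lambda>c. X (Suc i) c b) a = mv (B i) (X i) (\<lambda>c. D i c b) a"
    and X0: "X 0 bot bot = 0"
  shows "\<exists>s. (\<forall>i. \<forall>a\<in>B (Suc i). \<forall>b\<in>B i. homogeneous (g i b - g (Suc i) a) (s i a b)) \<and>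
    (\<forall>a b. s 0 a b = 0) \<and>
    (\<forall>i. \<forall>a\<in>B (Suc i). \<forall>b\<in>B (Suc i).
      mv (B (Suc (Suc i))) (D (Suc i)) (\<lambda>c. s (Suc i) c b) a =
      X (Suc i) a b - mv (B i) (s i) (\<lambda>c. D i c b) a)"
proof -
  \<comment> \<open>\<open>P\<close> includes solvability of the next lifting problem, and
    \<open>Q\<close> is the homotopy equation between consecutive maps. Exactness is applied only to
    establish \<open>P\<close> again.\<close>
  define P where "P i s \<longleftrightarrow> (i = 0 \<longrightarrow> (\<forall>a b. s a b = 0)) \<and>
     (\<forall>a\<in>B (Suc i). \<forall>b\<in>B i. homogeneous (g i b - g (Suc i) a) (s a b)) \<and>
     (\<forall>b\<in>B (Suc i). \<exists>w. \<forall>a\<in>B (Suc i).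
        X (Suc i) a b - mv (B i) s (\<lambda>c. D i c b) a = mv (B (Suc (Suc i))) (D (Suc i)) w a)" for i s
  define Q where "Q i s t \<longleftrightarrow> (\<forall>a\<in>B (Suc i). \<forall>b\<in>B (Suc i).
      mv (B (Suc (Suc i))) (D (Suc i)) (\<lambda>c. t c b) a = X (Suc i) a b - mv (B i) s (\<lambda>c. D i c b) a)"
    for i s and t :: "'b \<Rightarrow> 'b \<Rightarrow> ('n, 'k) mpol"
  have "\<exists>f. \<forall>n. P n (f n) \<and> Q n (f n) (f (Suc n))"
  proof (rule dependent_nat_choice)
    have "\<exists>w. \<forall>a\<in>B (Suc 0). X (Suc 0) a b = mv (B (Suc (Suc 0))) (D (Suc 0)) w a"
      if "b \<in> B (Suc 0)" for b
    proof (rule exact)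
      fix a assume "a \<in> B 0"
      with comm[OF this that] show "mv (B (Suc 0)) (D 0) (\<lambda>c. X (Suc 0) c b) a = 0"
        using X0 by (simp add: B_0 mv_def)
    qed
    hence "P 0 (\<lambda>_ _. 0)" by (simp add: P_def mv_def)
    thus "\<exists>s. P 0 s" by blast
  next
    fix s i assume s: "P i s"
    let ?M = "\<lambda>a b. X (Suc i) a b - mv (B i) s (\<lambda>c. D i c b) a"
    obtain t where t: "\<And>c b. c \<in> B (Suc (Suc i)) \<Longrightarrow> b \<in> B (Suc i) \<Longrightarrow>
          homogeneous (g (Suc i) b - g (Suc (Suc i)) c) (t c b)"
      and Dt: "\<And>a b. a \<in> B (Suc i) \<Longrightarrow> b \<in> B (Suc i) \<Longrightarrow>
          mv (B (Suc (Suc i))) (D (Suc i)) (\<lambda>c. t c b) a = ?M a b"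
    proof (rule homogeneous_lift[of "B (Suc i)" "B (Suc (Suc i))" "g (Suc (Suc i))" "g (Suc i)"
          "D (Suc i)" "B (Suc i)" "g (Suc i)" ?M])
      show "homogeneous (g (Suc i) b - g (Suc i) a) (?M a b)" if "a \<in> B (Suc i)" "b \<in> B (Suc i)" for a b
        by (intro homogeneous_diff hom that homogeneous_mv[where h = "g i"] hom_D)
           (use s that in \<open>auto simp: P_def\<close>)
      show "\<exists>w. \<forall>a\<in>B (Suc i). ?M a b = mv (B (Suc (Suc i))) (D (Suc i)) w a" if "b \<in> B (Suc i)" for b
        using s that unfolding P_def by blast
    qed (auto intro: hom_D)
    \<comment> \<open>By \<open>D X = X D\<close>, \<open>D t = X - s D\<close> and
      \<open>D D = 0\<close>, the columns of \<open>X - t D\<close> are cycles.\<close>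
    have "\<exists>w. \<forall>a\<in>B (Suc (Suc i)). X (Suc (Suc i)) a b - mv (B (Suc i)) t (\<lambda>c. D (Suc i) c b) a =
            mv (B (Suc (Suc (Suc i)))) (D (Suc (Suc i))) w a"
      if b: "b \<in> B (Suc (Suc i))" for b
    proof (rule exact)
      fix a assume a: "a \<in> B (Suc i)"
      let ?d = "\<lambda>c. D (Suc i) c b"
      have 1: "mv (B (Suc (Suc i))) (D (Suc i)) (\<lambda>c. X (Suc (Suc i)) c b) a = mv (B (Suc i)) (X (Suc i)) ?d a"
        by (rule comm[OF a b])
      have "mv (B (Suc (Suc i))) (D (Suc i)) (mv (B (Suc i)) t ?d) a = mv (B (Suc i)) ?M ?d a"
        unfolding mv_assoc by (rule mv_cong) (auto simp: Dt a)
      also have "\<dots> = mv (B (Suc i)) (X (Suc i)) ?d a - mv (B (Suc i)) (\<lambda>a b. mv (B i) s (\<lambda>c. D i c b) a) ?d a"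
        by (rule mv_diff_left)
      also have "mv (B (Suc i)) (\<lambda>a b. mv (B i) s (\<lambda>c. D i c b) a) ?d a = mv (B i) s (mv (B (Suc i)) (D i) ?d) a"
        by (rule mv_assoc[symmetric])
      also have "\<dots> = 0" by (rule mv_eq_0) (rule DD[OF _ b])
      finally show "mv (B (Suc (Suc i))) (D (Suc i))
          (\<lambda>a. X (Suc (Suc i)) a b - mv (B (Suc i)) t ?d a) a = 0"
        by (simp add: mv_diff 1)
    qed
    hence "P (Suc i) t" unfolding P_def using t by simp
    moreover have "Q i s t" unfolding Q_def using Dt by blast
    ultimately show "\<exists>t. P (Suc i) t \<and> Q i s t" by blast
  qed
  then obtain f where "\<And>n. P n (f n)" "\<And>n. Q n (f n) (f (Suc n))" by blast
  thus ?thesis by (intro exI[of _ f]) (auto simp: P_def Q_def)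
qed

end

locale free_res_pair = L: free_res B g D bot + R: free_res B' g' D' bot'
  for B :: "nat \<Rightarrow> 'b set" and g and D :: "nat \<Rightarrow> 'b \<Rightarrow> 'b \<Rightarrow> ('n::finite, 'k::field) mpol" and bot
    and B' :: "nat \<Rightarrow> 'c set" and g' and D' :: "nat \<Rightarrow> 'c \<Rightarrow> 'c \<Rightarrow> ('n::finite, 'k::field) mpol" and bot' +
  assumes image_eq: "L.image = R.image"
begin

text \<open>A lift of the identity of \<open>S\<close>: equality of the two ideals permits the first
  step, exactness of the target the later ones.\<close>

lemma chain_map:
  obtains \<phi> where
    "\<And>i a b. a \<in> B' i \<Longrightarrow> b \<in> B i \<Longrightarrow> homogeneous (g i b - g' i a) (\<phi> i a b)"
    and "\<phi> 0 bot' bot = 1"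
    and "\<And>i a b. a \<in> B' i \<Longrightarrow> b \<in> B (Suc i) \<Longrightarrow>
      mv (B' (Suc i)) (D' i) (\<lambda>c. \<phi> (Suc i) c b) a = mv (B i) (\<phi> i) (\<lambda>c. D i c b) a"
proof -
  define P where "P i s \<longleftrightarrow> (i = 0 \<longrightarrow> s bot' bot = 1) \<and>
     (\<forall>a\<in>B' i. \<forall>b\<in>B i. homogeneous (g i b - g' i a) (s a b)) \<and>
     (\<forall>b\<in>B (Suc i). \<exists>w. \<forall>a\<in>B' i. mv (B i) s (\<lambda>c. D i c b) a = mv (B' (Suc i)) (D' i) w a)" for i s
  define Q where "Q i s t \<longleftrightarrow> (\<forall>a\<in>B' i. \<forall>b\<in>B (Suc i).
      mv (B' (Suc i)) (D' i) (\<lambda>c. t c b) a = mv (B i) s (\<lambda>c. D i c b) a)"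
    for i s and t :: "'c \<Rightarrow> 'b \<Rightarrow> ('n, 'k) mpol"
  have "\<exists>f. \<forall>n. P n (f n) \<and> Q n (f n) (f (Suc n))"
  proof (rule dependent_nat_choice)
    \<comment> \<open>As the image of a unit vector, \<open>D 0 bot b\<close> lies in the common
      ideal and is a combination of the generators given by the other complex.\<close>
    have "\<exists>w. D 0 bot b = mv (B' (Suc 0)) (D' 0) w bot'" if "b \<in> B (Suc 0)" for b
    proof -
      have "D 0 bot b = mv (B 1) (D 0) (\<lambda>c. if c = b then 1 else 0) bot"
        using that L.finite_B by (simp add: mv_unit)
      hence "D 0 bot b \<in> L.image" unfolding L.image_def by blast
      thus ?thesis unfolding image_eq R.image_def by auto
    qed
    hence "P 0 (\<lambda>_ _. 1)"
      by (simp add: P_def L.B_0 R.B_0 mv_def L.g_bot R.g_bot)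
    thus "\<exists>s. P 0 s" by blast
  next
    fix s i assume s: "P i s"
    let ?M = "\<lambda>a b. mv (B i) s (\<lambda>c. D i c b) a"
    obtain t where t: "\<And>c b. c \<in> B' (Suc i) \<Longrightarrow> b \<in> B (Suc i) \<Longrightarrow>
          homogeneous (g (Suc i) b - g' (Suc i) c) (t c b)"
      and Dt: "\<And>a b. a \<in> B' i \<Longrightarrow> b \<in> B (Suc i) \<Longrightarrow> mv (B' (Suc i)) (D' i) (\<lambda>c. t c b) a = ?M a b"
    proof (rule homogeneous_lift[of "B' i" "B' (Suc i)" "g' (Suc i)" "g' i" "D' i" "B (Suc i)" "g (Suc i)" ?M])
      show "homogeneous (g (Suc i) b - g' i a) (?M a b)" if "a \<in> B' i" "b \<in> B (Suc i)" for a b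
        by (intro that homogeneous_mv[where h = "g i"] L.hom_D)
           (use s that in \<open>auto simp: P_def\<close>)
      show "\<exists>w. \<forall>a\<in>B' i. ?M a b = mv (B' (Suc i)) (D' i) w a" if "b \<in> B (Suc i)" for b
        using s that unfolding P_def by blast
    qed (auto intro: R.hom_D)
    have "\<exists>w. \<forall>a\<in>B' (Suc i). mv (B (Suc i)) t (\<lambda>c. D (Suc i) c b) a = mv (B' (Suc (Suc i))) (D' (Suc i)) w a"
      if b: "b \<in> B (Suc (Suc i))" for b
    proof (rule R.exact)
      fix a assume a: "a \<in> B' i"
      let ?d = "\<lambda>c. D (Suc i) c b"
      have "mv (B' (Suc i)) (D' i) (mv (B (Suc i)) t ?d) a = mv (B (Suc i)) ?M ?d a"
        unfolding mv_assoc by (rule mv_cong) (auto simp: Dt a)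
      also have "\<dots> = mv (B i) s (mv (B (Suc i)) (D i) ?d) a"
        by (rule mv_assoc[symmetric])
      also have "\<dots> = 0" by (rule mv_eq_0) (rule L.DD[OF _ b])
      finally show "mv (B' (Suc i)) (D' i) (mv (B (Suc i)) t ?d) a = 0" .
    qed
    hence "P (Suc i) t" unfolding P_def using t by simp
    moreover have "Q i s t" unfolding Q_def using Dt by blast
    ultimately show "\<exists>t. P (Suc i) t \<and> Q i s t" by blast
  qed
  then obtain f where "\<And>n. P n (f n)" "\<And>n. Q n (f n) (f (Suc n))" by blast
  thus thesis by (intro that[of f]) (auto simp: P_def Q_def)
qed

text \<open>If \<open>Tor\<close> of the target vanished, the image of a cycle under
  \<open>\<phi>\<close> would bound, and the homotopy between \<open>\<psi> \<phi>\<close> and the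
  identity would turn this into a bounding chain of the cycle itself. Homogeneity of all maps keeps
  the internal degree at \<open>j\<close>.\<close>

lemma tor_nz_imp:
  assumes "L.tor_nz p j"
  shows "R.tor_nz p j"
proof (rule ccontr)
  assume nR: "\<not> R.tor_nz p j"
  obtain \<phi> where \<phi>h: "\<And>i a b. a \<in> B' i \<Longrightarrow> b \<in> B i \<Longrightarrow> homogeneous (g i b - g' i a) (\<phi> i a b)"
    and \<phi>0: "\<phi> 0 bot' bot = 1"
    and \<phi>c: "\<And>i a b. a \<in> B' i \<Longrightarrow> b \<in> B (Suc i) \<Longrightarrow>
      mv (B' (Suc i)) (D' i) (\<lambda>c. \<phi> (Suc i) c b) a = mv (B i) (\<phi> i) (\<lambda>c. D i c b) a"
    by (rule chain_map) blast
  interpret flip: free_res_pair B' g' D' bot' B g D bot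
    by unfold_locales (rule image_eq[symmetric])
  obtain \<psi> where \<psi>h: "\<And>i a b. a \<in> B i \<Longrightarrow> b \<in> B' i \<Longrightarrow> homogeneous (g' i b - g i a) (\<psi> i a b)"
    and \<psi>0: "\<psi> 0 bot bot' = 1"
    and \<psi>c: "\<And>i a b. a \<in> B i \<Longrightarrow> b \<in> B' (Suc i) \<Longrightarrow>
      mv (B (Suc i)) (D i) (\<lambda>c. \<psi> (Suc i) c b) a = mv (B' i) (\<psi> i) (\<lambda>c. D' i c b) a"
    by (rule flip.chain_map) blast
  define X where "X i a b = mv (B' i) (\<psi> i) (\<lambda>c. \<phi> i c b) a - (if a = b then 1 else 0)" for i a b
  have Xh: "homogeneous (g i b - g i a) (X i a b)" if "a \<in> B i" "b \<in> B i" for i a b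
    unfolding X_def
    by (intro homogeneous_diff homogeneous_mv[where h = "g' i"] \<phi>h \<psi>h that) auto
  have X0: "X 0 bot bot = 0"
    by (simp add: X_def mv_def R.B_0 \<phi>0 \<psi>0)
  have Xc: "mv (B (Suc i)) (D i) (\<lambda>c. X (Suc i) c b) a = mv (B i) (X i) (\<lambda>c. D i c b) a"
    if a: "a \<in> B i" and b: "b \<in> B (Suc i)" for i a b
  proof -
    have "mv (B (Suc i)) (D i) (\<lambda>c. X (Suc i) c b) a =
        mv (B (Suc i)) (D i) (mv (B' (Suc i)) (\<psi> (Suc i)) (\<lambda>c. \<phi> (Suc i) c b)) a - D i a b"
      unfolding X_def by (simp add: mv_diff mv_unit L.finite_B b)
    also have "mv (B (Suc i)) (D i) (mv (B' (Suc i)) (\<psi> (Suc i)) (\<lambda>c. \<phi> (Suc i) c b)) a =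
        mv (B' (Suc i)) (\<lambda>a d. mv (B' i) (\<psi> i) (\<lambda>c. D' i c d) a) (\<lambda>c. \<phi> (Suc i) c b) a"
      unfolding mv_assoc by (rule mv_cong) (auto simp: \<psi>c a)
    also have "\<dots> = mv (B' i) (\<psi> i) (mv (B' (Suc i)) (D' i) (\<lambda>c. \<phi> (Suc i) c b)) a"
      by (rule mv_assoc[symmetric])
    also have "\<dots> = mv (B' i) (\<psi> i) (mv (B i) (\<phi> i) (\<lambda>c. D i c b)) a"
      by (rule mv_cong) (auto simp: \<phi>c b)
    also have "\<dots> = mv (B i) (\<lambda>a d. mv (B' i) (\<psi> i) (\<lambda>c. \<phi> i c d) a) (\<lambda>c. D i c b) a"
      by (rule mv_assoc)
    also have "\<dots> - D i a b = mv (B i) (X i) (\<lambda>c. D i c b) a"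
      unfolding X_def by (simp add: mv_diff_left mv_id L.finite_B a)
    finally show ?thesis .
  qed
  obtain s where sh: "\<And>i a b. a \<in> B (Suc i) \<Longrightarrow> b \<in> B i \<Longrightarrow> homogeneous (g i b - g (Suc i) a) (s i a b)"
    and s0: "\<And>a b. s 0 a b = 0"
    and sX: "\<And>i a b. a \<in> B (Suc i) \<Longrightarrow> b \<in> B (Suc i) \<Longrightarrow>
      mv (B (Suc (Suc i))) (D (Suc i)) (\<lambda>c. s (Suc i) c b) a =
      X (Suc i) a b - mv (B i) (s i) (\<lambda>c. D i c b) a"
    using L.null_homotopy[of X, OF Xh Xc X0] by blast
  let ?p = "Suc p" and ?q = "Suc (Suc p)"
  from assms obtain z where z: "\<And>b. b \<in> B ?p \<Longrightarrow> z b \<noteq> 0 \<Longrightarrow> g ?p b = j"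
    and zc: "\<And>a. p \<noteq> 0 \<Longrightarrow> a \<in> B p \<Longrightarrow> mv (B ?p) (cc (D p)) z a = 0"
    and zb: "\<not> (\<exists>w. (\<forall>c\<in>B ?q. w c \<noteq> 0 \<longrightarrow> g ?q c = j) \<and>
            (\<forall>b\<in>B ?p. z b = mv (B ?q) (cc (D ?p)) w b))"
    unfolding L.tor_nz_def by (elim exE conjE) (rule that, simp_all)
  define z' where "z' = mv (B ?p) (cc (\<phi> ?p)) z"
  have z': "g' ?p a = j" if "a \<in> B' ?p" "z' a \<noteq> 0" for a
    by (rule degree_mv_nonzero[OF that(2)[unfolded z'_def], of "g ?p"]) (use z \<phi>h that in auto)
  have z'c: "mv (B' ?p) (cc (D' p)) z' a = 0" if "p \<noteq> 0" "a \<in> B' p" for a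
  proof -
    have "mv (B' ?p) (cc (D' p)) z' a = mv (B ?p) (\<lambda>a b. mv (B p) (cc (\<phi> p)) (\<lambda>c. cc (D p) c b) a) z a"
      unfolding z'_def mv_assoc
      by (rule mv_cong) (auto simp: \<phi>c that lookup_mv_0[symmetric])
    also have "\<dots> = mv (B p) (cc (\<phi> p)) (mv (B ?p) (cc (D p)) z) a" by (rule mv_assoc[symmetric])
    also have "\<dots> = 0" by (rule mv_eq_0) (rule zc[OF that(1)])
    finally show ?thesis .
  qed
  have "\<exists>w. (\<forall>c\<in>B' ?q. w c \<noteq> 0 \<longrightarrow> g' ?q c = j) \<and> (\<forall>b\<in>B' ?p. z' b = mv (B' ?q) (cc (D' ?p)) w b)"
    by (rule R.not_tor_nzD[OF nR]) (simp_all add: z' z'c)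
  then obtain w where w: "\<And>c. c \<in> B' ?q \<Longrightarrow> w c \<noteq> 0 \<Longrightarrow> g' ?q c = j"
    and Dw: "\<And>b. b \<in> B' ?p \<Longrightarrow> z' b = mv (B' ?q) (cc (D' ?p)) w b"
    by (elim exE conjE) (rule that, simp_all)
  \<comment> \<open>\<open>D \<psi> w = \<psi> \<phi> z\<close>, and
    \<open>D s z = \<psi> \<phi> z - z\<close> because \<open>s D z = 0\<close>. The difference of
    the two is \<open>z\<close>.\<close>
  define u where "u c = mv (B' ?q) (cc (\<psi> ?q)) w c - mv (B ?p) (cc (s ?p)) z c" for c
  have "g ?q c = j" if "c \<in> B ?q" "u c \<noteq> 0" for c
  proof -
    from that(2) consider "mv (B' ?q) (cc (\<psi> ?q)) w c \<noteq> 0" | "mv (B ?p) (cc (s ?p)) z c \<noteq> 0"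
      unfolding u_def by fastforce
    thus ?thesis
    proof cases
      case 1
      show ?thesis by (rule degree_mv_nonzero[OF 1, of "g' ?q"]) (use w \<psi>h that in auto)
    next
      case 2
      show ?thesis by (rule degree_mv_nonzero[OF 2, of "g ?p"]) (use z sh that in auto)
    qed
  qed
  moreover have "z b = mv (B ?q) (cc (D ?p)) u b" if b: "b \<in> B ?p" for b
  proof -
    have 1: "mv (B ?q) (cc (D ?p)) (mv (B' ?q) (cc (\<psi> ?q)) w) b = mv (B' ?p) (cc (\<psi> ?p)) z' b"
    proof -
      have "mv (B ?q) (cc (D ?p)) (mv (B' ?q) (cc (\<psi> ?q)) w) b =
          mv (B' ?q) (\<lambda>a d. mv (B' ?p) (cc (\<psi> ?p)) (\<lambda>c. cc (D' ?p) c d) a) w b"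
        unfolding mv_assoc by (rule mv_cong) (auto simp: \<psi>c b lookup_mv_0[symmetric])
      also have "\<dots> = mv (B' ?p) (cc (\<psi> ?p)) (mv (B' ?q) (cc (D' ?p)) w) b"
        by (rule mv_assoc[symmetric])
      also have "\<dots> = mv (B' ?p) (cc (\<psi> ?p)) z' b" by (rule mv_cong) (auto simp: Dw)
      finally show ?thesis .
    qed
    \<comment> \<open>For \<open>p = 0\<close> it is \<open>s 0 = 0\<close>, and not a cycle
      condition on \<open>z\<close>, that makes this term vanish.\<close>
    have sp: "mv (B p) (cc (s p)) (mv (B ?p) (cc (D p)) z) b = 0"
    proof (cases "p = 0")
      case True
      thus ?thesis by (simp add: mv_def s0)
    next
      case False
      thus ?thesis by (intro mv_eq_0 zc)
    qed
    have "mv (B ?q) (cc (D ?p)) (mv (B ?p) (cc (s ?p)) z) b =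
        mv (B ?p) (\<lambda>a c. cc (X ?p) a c - mv (B p) (cc (s p)) (\<lambda>d. cc (D p) d c) a) z b"
      unfolding mv_assoc
      by (rule mv_cong) (auto simp: sX b lookup_mv_0[symmetric] lookup_minus)
    also have "\<dots> = mv (B ?p) (cc (X ?p)) z b"
      unfolding mv_diff_left mv_assoc[symmetric] sp by simp
    also have "\<dots> = mv (B ?p) (\<lambda>a c. mv (B' ?p) (cc (\<psi> ?p)) (\<lambda>d. cc (\<phi> ?p) d c) a - (if a = c then 1 else 0)) z b"
      by (rule mv_cong) (auto simp: X_def lookup_minus lookup_mv_0 lookup_one)
    also have "\<dots> = mv (B' ?p) (cc (\<psi> ?p)) z' b - z b"
      unfolding mv_diff_left mv_assoc[symmetric] z'_def by (simp add: mv_id L.finite_B b)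
    finally show ?thesis unfolding u_def mv_diff 1 by simp
  qed
  ultimately have "\<exists>w. (\<forall>c\<in>B ?q. w c \<noteq> 0 \<longrightarrow> g ?q c = j) \<and> (\<forall>b\<in>B ?p. z b = mv (B ?q) (cc (D ?p)) w b)"
    by (intro exI[of _ u]) simp
  with zb show False by (rule notE)
qed

lemma tor_nz_iff: "L.tor_nz p j \<longleftrightarrow> R.tor_nz p j"
proof -
  interpret flip: free_res_pair B' g' D' bot' B g D bot
    by unfold_locales (rule image_eq[symmetric])
  show ?thesis using tor_nz_imp flip.tor_nz_imp by blast
qed

end

subsection \<open>The Taylor complex\<close>

definition mdvd :: "'n::finite mon \<Rightarrow> 'n mon \<Rightarrow> bool" where
  "mdvd a b \<longleftrightarrow> (\<forall>x. Poly_Mapping.lookup a x \<le> Poly_Mapping.lookup b x)"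

text \<open>Subtraction of exponents is truncated; under divisibility it is division of
  monomials.\<close>

lemma mdvd_diff_add: "mdvd a b \<Longrightarrow> b - a + a = b"
  by (simp add: mdvd_def poly_mapping_eq_iff fun_eq_iff lookup_add lookup_minus)

lemma mdvd_add: "mdvd a (b + a)"
  by (simp add: mdvd_def lookup_add)

lemma mon_deg_diff:
  assumes "mdvd a b"
  shows "int (mon_deg (b - a)) = int (mon_deg b) - int (mon_deg a)"
proof -
  have "mon_deg b = mon_deg (b - a) + mon_deg a"
    using mon_deg_add[of "b - a" a] mdvd_diff_add[OF assms] by simp
  thus ?thesis by simp
qed

text \<open>A proper divisor has smaller total degree. Hence total degrees alone decide which
  entries of the Taylor differential survive modulo the variables.\<close>

lemma mdvd_diff_eq_0_iff: "mdvd a b \<Longrightarrow> b - a = 0 \<longleftrightarrow> mon_deg b = mon_deg a"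
  using mon_deg_diff[of a b] mon_deg_eq_0_iff[of "b - a"] by linarith

lemma lookup_single_mult:
  "Poly_Mapping.lookup (Poly_Mapping.single m a * p) u =
     (if mdvd m u then a * Poly_Mapping.lookup p (u - m) else (0 :: 'k::field))"
proof -
  have eq: "u = m + q \<longleftrightarrow> mdvd m u \<and> q = u - m" for q
    by (metis add.commute add_diff_cancel_right' mdvd_add mdvd_diff_add)
  have "(\<Sum>l. Poly_Mapping.lookup (Poly_Mapping.single m a) l * (\<Sum>q. Poly_Mapping.lookup p q when u = l + q)) =
        (\<Sum>l. a * (\<Sum>q. Poly_Mapping.lookup p q when u = m + q) when l = m)"
    by (rule Sum_any.cong) (auto simp: lookup_single when_def)
  also have "\<dots> = a * (\<Sum>q. Poly_Mapping.lookup p q when u = m + q)" by simp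
  also have "(\<Sum>q. Poly_Mapping.lookup p q when u = m + q) = (if mdvd m u then Poly_Mapping.lookup p (u - m) else 0)"
    by (cases "mdvd m u") (simp_all add: eq)
  finally show ?thesis by (simp add: lookup_mult)
qed

lemma mdvd_mon_lcm_iff:
  "finite F \<Longrightarrow> mdvd (mon_lcm f F) u \<longleftrightarrow> (\<forall>l\<in>F. mdvd (f l) u)"
  by (auto simp: mdvd_def lookup_mon_lcm)

lemma mon_lcm_empty [simp]: "mon_lcm f {} = 0"
  by (simp add: poly_mapping_eq_iff fun_eq_iff lookup_mon_lcm)

lemma mon_lcm_single [simp]: "mon_lcm f {l} = f l"
  by (simp add: poly_mapping_eq_iff fun_eq_iff lookup_mon_lcm)

lemma mon_lcm_mono: "finite F \<Longrightarrow> G \<subseteq> F \<Longrightarrow> mdvd (mon_lcm f G) (mon_lcm f F)"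
  unfolding mdvd_def lookup_mon_lcm by (intro allI Max_mono) auto

lemma mon_deg_mono: "mdvd a b \<Longrightarrow> mon_deg a \<le> mon_deg b"
  by (auto simp: mdvd_def mon_deg_def intro: sum_mono)

definition faces :: "nat set \<Rightarrow> nat \<Rightarrow> nat set set" where
  "faces V i = {F. F \<subseteq> V \<and> card F = i}"

text \<open>For faces of consecutive cardinality \<open>F - G\<close> is a single vertex, which
  \<open>Min\<close> extracts. One matrix thus serves in all homological degrees.\<close>

definition taylor :: "(nat \<Rightarrow> 'n::finite mon) \<Rightarrow> nat set \<Rightarrow> nat set \<Rightarrow> ('n, 'k::field) mpol" where
  "taylor f G F = (if G \<subseteq> F
     then Poly_Mapping.single (mon_lcm f F - mon_lcm f G) ((-1) ^ card {w\<in>G. w < Min (F - G)}) else 0)"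

definition lcm_deg :: "(nat \<Rightarrow> 'n::finite mon) \<Rightarrow> nat set \<Rightarrow> nat" where
  "lcm_deg f F = mon_deg (mon_lcm f F)"

lemma sum_faces:
  assumes V: "finite V" and G: "G \<in> faces V i" and h: "\<And>F. \<not> G \<subseteq> F \<Longrightarrow> h F = 0"
  shows "(\<Sum>F\<in>faces V (Suc i). h F) = (\<Sum>v\<in>V - G. h (insert v G))"
proof -
  have G': "G \<subseteq> V" "card G = i" "finite G" using G V finite_subset by (auto simp: faces_def)
  have inj: "inj_on (\<lambda>v. insert v G) (V - G)" by (auto simp: inj_on_def)
  have "(\<lambda>v. insert v G) ` (V - G) = {F\<in>faces V (Suc i). G \<subseteq> F}"
  proof (intro equalityI subsetI)
    fix F assume "F \<in> {F\<in>faces V (Suc i). G \<subseteq> F}"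
    hence F: "F \<subseteq> V" "card F = Suc i" "G \<subseteq> F" by (auto simp: faces_def)
    have "finite F" using F(1) V finite_subset by auto
    have "card (F - G) = 1" using F G' by (simp add: card_Diff_subset)
    then obtain v where "F - G = {v}" by (auto simp: card_1_singleton_iff)
    hence "F = insert v G" "v \<in> V - G" using F by auto
    thus "F \<in> (\<lambda>v. insert v G) ` (V - G)" by blast
  qed (use G' in \<open>auto simp: faces_def\<close>)
  moreover have "finite (faces V (Suc i))" using V by (simp add: faces_def)
  hence "(\<Sum>F\<in>faces V (Suc i). h F) = (\<Sum>F\<in>{F\<in>faces V (Suc i). G \<subseteq> F}. h F)"
    by (intro sum.mono_neutral_right) (auto simp: h)
  moreover have "(\<Sum>v\<in>V - G. h (insert v G)) = sum h ((\<lambda>v. insert v G) ` (V - G))"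
    by (simp add: sum.reindex[OF inj])
  ultimately show ?thesis by simp
qed

context
  fixes V :: "nat set" and f :: "nat \<Rightarrow> 'n::finite mon"
  assumes V: "finite V"
begin

lemma finite_face: "F \<in> faces V i \<Longrightarrow> finite F"
  using V finite_subset by (auto simp: faces_def)

lemma finite_faces: "finite (faces V i)"
  using V by (simp add: faces_def)

lemma mv_taylor:
  assumes G: "G \<in> faces V i"
  shows "mv (faces V (Suc i)) (taylor f) x G = (\<Sum>v\<in>V - G.
    Poly_Mapping.single (mon_lcm f (insert v G) - mon_lcm f G) ((-1) ^ card {w\<in>G. w < v}) * x (insert v G))"
proof -
  have "insert v G - G = {v}" if "v \<in> V - G" for v using that by auto
  thus ?thesis unfolding mv_def
    by (subst sum_faces[OF V G]) (auto simp: taylor_def intro!: sum.cong)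
qed

text \<open>The part of the Taylor complex in multidegree \<open>u\<close> is the simplicial chain complex of the full
  simplex on the vertices \<open>v\<close> for which \<open>f v\<close> divides \<open>u\<close>.\<close>

definition strand :: "nat \<Rightarrow> 'n mon \<Rightarrow> (nat set \<Rightarrow> ('n, 'k::field) mpol) \<Rightarrow> nat set \<Rightarrow> 'k" where
  "strand i u x F = (if F \<in> faces V i \<and> mdvd (mon_lcm f F) u
     then Poly_Mapping.lookup (x F) (u - mon_lcm f F) else 0)"

text \<open>The coefficient of \<open>x F\<close> at \<open>u - mon_lcm f F\<close> has multidegree
  \<open>u\<close>. The monomial of a Taylor entry is the quotient of two lcms and accounts for the
  shift between the faces, so that only the sign remains.\<close>

lemma bd_strand:
  fixes x :: "nat set \<Rightarrow> ('n, 'k::field) mpol"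
  shows "bd V (strand (Suc i) u x) = strand i u (mv (faces V (Suc i)) (taylor f) x)"
proof
  fix G
  show "bd V (strand (Suc i) u x) G = strand i u (mv (faces V (Suc i)) (taylor f) x) G"
  proof (cases "G \<in> faces V i \<and> mdvd (mon_lcm f G) u")
    case True
    hence G: "G \<in> faces V i" "finite G" and u: "mdvd (mon_lcm f G) u" by (auto simp: finite_face)
    have "strand i u (mv (faces V (Suc i)) (taylor f) x) G = (\<Sum>v\<in>V - G.
        Poly_Mapping.lookup (Poly_Mapping.single (mon_lcm f (insert v G) - mon_lcm f G)
          ((-1) ^ card {w\<in>G. w < v}) * x (insert v G)) (u - mon_lcm f G))"
      using True by (simp add: strand_def mv_taylor lookup_sum)
    also have "\<dots> = (\<Sum>v\<in>V - G. (-1) ^ card {w\<in>G. w < v} * strand (Suc i) u x (insert v G))"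
    proof (rule sum.cong)
      fix v assume v: "v \<in> V - G"
      let ?a = "mon_lcm f G" and ?b = "mon_lcm f (insert v G)"
      have ab: "mdvd ?a ?b" using G by (intro mon_lcm_mono) auto
      have "mdvd (?b - ?a) (u - ?a) \<longleftrightarrow> mdvd ?b u"
        using ab u unfolding mdvd_def lookup_minus by (meson diff_le_mono le_diff_iff)
      moreover have "u - ?a - (?b - ?a) = u - ?b"
        using ab u by (simp add: mdvd_def poly_mapping_eq_iff fun_eq_iff lookup_minus)
      moreover have "insert v G \<in> faces V (Suc i)" using v G by (auto simp: faces_def)
      ultimately show "Poly_Mapping.lookup (Poly_Mapping.single (?b - ?a)
          ((-1) ^ card {w\<in>G. w < v}) * x (insert v G)) (u - ?a) =
          (-1) ^ card {w\<in>G. w < v} * strand (Suc i) u x (insert v G)"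
        by (simp add: lookup_single_mult strand_def)
    qed simp
    finally show ?thesis by (simp add: bd_def)
  next
    case False
    have "bd V (strand (Suc i) u x) G = 0"
    proof (rule ccontr)
      assume "bd V (strand (Suc i) u x) G \<noteq> 0"
      then obtain v where v: "v \<in> V" "v \<notin> G" "strand (Suc i) u x (insert v G) \<noteq> 0"
        by (rule bd_nonzeroD)
      hence 1: "insert v G \<in> faces V (Suc i)" "mdvd (mon_lcm f (insert v G)) u"
        by (auto simp: strand_def split: if_splits)
      have "finite G" using finite_face[OF 1(1)] by simp
      hence "G \<in> faces V i" "mdvd (mon_lcm f G) u"
        using 1 v by (auto simp: faces_def mdvd_mon_lcm_iff)
      with False show False by blast
    qed
    moreover have "strand i u (mv (faces V (Suc i)) (taylor f) x) G = 0"
      using False unfolding strand_def by (rule if_not_P)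
    ultimately show ?thesis by simp
  qed
qed

lemma strand_eqD:
  assumes "\<And>u. strand i u x F = strand i u y F" "F \<in> faces V i"
  shows "x F = y F"
proof (rule poly_mapping_eqI)
  fix m
  have "mdvd (mon_lcm f F) (m + mon_lcm f F)" by (rule mdvd_add)
  thus "Poly_Mapping.lookup (x F) m = Poly_Mapping.lookup (y F) m"
    using assms(1)[of "m + mon_lcm f F"] assms(2) by (simp add: strand_def)
qed

text \<open>Needed to glue solutions in single multidegrees into polynomials.\<close>

lemma finite_strands:
  "finite {u. strand i u x \<noteq> (\<lambda>_. 0)}"
proof (rule finite_subset)
  show "{u. strand i u x \<noteq> (\<lambda>_. 0)} \<subseteq>
      (\<Union>F\<in>faces V i. (\<lambda>m. m + mon_lcm f F) ` Poly_Mapping.keys (x F))"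
  proof
    fix u assume "u \<in> {u. strand i u x \<noteq> (\<lambda>_. 0)}"
    then obtain F where F: "F \<in> faces V i" "mdvd (mon_lcm f F) u"
        "Poly_Mapping.lookup (x F) (u - mon_lcm f F) \<noteq> 0"
      by (auto simp: strand_def fun_eq_iff split: if_splits)
    have "u \<in> (\<lambda>m. m + mon_lcm f F) ` Poly_Mapping.keys (x F)"
      using F by (intro image_eqI[of _ _ "u - mon_lcm f F"]) (simp_all add: in_keys_iff mdvd_diff_add)
    with F(1) show "u \<in> (\<Union>F\<in>faces V i. (\<lambda>m. m + mon_lcm f F) ` Poly_Mapping.keys (x F))"
      by blast
  qed
  show "finite (\<Union>F\<in>faces V i. (\<lambda>m. m + mon_lcm f F) ` Poly_Mapping.keys (x F))"
    by (intro finite_UN_I finite_faces finite_imageI finite_keys)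
qed

text \<open>Coning takes place in the simplex on the vertices \<open>v\<close> with
  \<open>f v\<close> dividing \<open>u\<close>. A zero strand must get the zero solution, since
  otherwise infinitely many multidegrees could contribute when the solutions are glued.\<close>

lemma strand_acyclic:
  fixes x :: "nat set \<Rightarrow> ('n, 'k::field) mpol"
  assumes "bd V (strand (Suc i) u x) = (\<lambda>_. 0)"
  shows "\<exists>b. (\<forall>F. b F \<noteq> 0 \<longrightarrow> F \<in> faces V (Suc (Suc i)) \<and> mdvd (mon_lcm f F) u) \<and>
    (strand (Suc i) u x = (\<lambda>_. 0) \<longrightarrow> b = (\<lambda>_. 0)) \<and> bd V b = strand (Suc i) u x"
proof (cases "strand (Suc i) u x = (\<lambda>_. 0)")
  case True
  thus ?thesis by (intro exI[of _ "\<lambda>_. 0"]) simp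
next
  case False
  define W where "W = {v\<in>V. mdvd (f v) u}"
  have W: "finite W" "W \<subseteq> V" using V by (auto simp: W_def)
  have supp: "F \<subseteq> W \<and> card F = Suc i" if "strand (Suc i) u x F \<noteq> 0" for F
  proof -
    from that have "F \<in> faces V (Suc i)" "mdvd (mon_lcm f F) u"
      by (auto simp: strand_def split: if_splits)
    thus ?thesis using finite_face[of F "Suc i"] by (auto simp: W_def mdvd_mon_lcm_iff faces_def)
  qed
  have bdW: "bd V c = bd W c" if c: "\<And>F. c F \<noteq> 0 \<Longrightarrow> F \<subseteq> W" for c :: "nat set \<Rightarrow> 'k"
  proof
    fix G
    have "c (insert v G) = 0" if "v \<notin> W" for v using c[of "insert v G"] that by auto
    thus "bd V c G = bd W c G" unfolding bd_def using V W by (intro sum.mono_neutral_right) auto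
  qed
  \<comment> \<open>Faces with \<open>Suc i\<close> vertices are nonempty, so a nonzero strand
    provides a vertex to cone from.\<close>
  from False obtain F where "strand (Suc i) u x F \<noteq> 0" by auto
  from supp[OF this] have "W \<noteq> {}" by auto
  moreover have "bd W (strand (Suc i) u x) G = 0" for G
    using assms bdW[of "strand (Suc i) u x"] supp by simp
  ultimately obtain b where b: "\<And>F. b F \<noteq> 0 \<Longrightarrow> F \<subseteq> W \<and> card F = Suc (Suc i)"
    and bb: "bd W b = strand (Suc i) u x"
    using simplex_acyclic[of W "strand (Suc i) u x" "Suc i"] supp W(1) by metis
  have "F \<in> faces V (Suc (Suc i)) \<and> mdvd (mon_lcm f F) u" if "b F \<noteq> 0" for F
  proof -
    have "finite F" using b[OF that] W finite_subset by blast
    thus ?thesis using b[OF that] W by (auto simp: faces_def mdvd_mon_lcm_iff W_def)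
  qed
  moreover have "bd V b = strand (Suc i) u x" using bdW[of b] b bb by simp
  ultimately show ?thesis using False by blast
qed

lemma taylor_exact:
  fixes x :: "nat set \<Rightarrow> ('n, 'k::field) mpol"
  assumes "\<And>G. G \<in> faces V i \<Longrightarrow> mv (faces V (Suc i)) (taylor f) x G = 0"
  shows "\<exists>w. \<forall>F\<in>faces V (Suc i). x F = mv (faces V (Suc (Suc i))) (taylor f) w F"
proof -
  have "strand i u (mv (faces V (Suc i)) (taylor f) x) = (\<lambda>_. 0)" for u
    using assms by (simp add: fun_eq_iff strand_def)
  hence "bd V (strand (Suc i) u x) = (\<lambda>_. 0)" for u by (simp add: bd_strand)
  hence "\<forall>u. \<exists>b. (\<forall>F. b F \<noteq> 0 \<longrightarrow> F \<in> faces V (Suc (Suc i)) \<and> mdvd (mon_lcm f F) u) \<and>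
    (strand (Suc i) u x = (\<lambda>_. 0) \<longrightarrow> b = (\<lambda>_. 0)) \<and> bd V b = strand (Suc i) u x"
    by (intro allI strand_acyclic)
  then obtain b where b: "\<And>u F. b u F \<noteq> 0 \<Longrightarrow> F \<in> faces V (Suc (Suc i)) \<and> mdvd (mon_lcm f F) u"
    and b0: "\<And>u. strand (Suc i) u x = (\<lambda>_. 0) \<Longrightarrow> b u = (\<lambda>_. 0)"
    and bb: "\<And>u. bd V (b u) = strand (Suc i) u x" by metis
  \<comment> \<open>The coefficient of \<open>w F\<close> at \<open>m\<close> belongs to multidegree
    \<open>m + mon_lcm f F\<close>, and is taken from the solution found there.\<close>
  define w where "w F = Abs_poly_mapping (\<lambda>m. b (m + mon_lcm f F) F)" for F
  have lw: "Poly_Mapping.lookup (w F) m = b (m + mon_lcm f F) F" for F m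
  proof -
    have "{m. b (m + mon_lcm f F) F \<noteq> 0} \<subseteq>
        (\<lambda>m. m + mon_lcm f F) -` {u. strand (Suc i) u x \<noteq> (\<lambda>_. 0)}"
      using b0 by fastforce
    moreover have "inj (\<lambda>m. m + mon_lcm f F)" by (simp add: inj_def)
    hence "finite ((\<lambda>m. m + mon_lcm f F) -` {u. strand (Suc i) u x \<noteq> (\<lambda>_. 0)})"
      by (intro finite_vimageI finite_strands)
    ultimately have "finite {m. b (m + mon_lcm f F) F \<noteq> 0}" using finite_subset by blast
    thus ?thesis by (simp add: w_def)
  qed
  have sw: "strand (Suc (Suc i)) u w = b u" for u
  proof
    fix F
    show "strand (Suc (Suc i)) u w F = b u F"
      using b[of u F] by (auto simp: strand_def lw mdvd_diff_add)
  qed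
  have "x F = mv (faces V (Suc (Suc i))) (taylor f) w F" if "F \<in> faces V (Suc i)" for F
  proof (rule strand_eqD[OF _ that])
    fix u
    show "strand (Suc i) u x F = strand (Suc i) u (mv (faces V (Suc (Suc i))) (taylor f) w) F"
      by (simp add: bd_strand[symmetric] sw bb)
  qed
  thus ?thesis by blast
qed

text \<open>Column \<open>H\<close> is the image of a unit vector, and on each strand the identity
  reduces to \<open>bd_bd\<close>; the signs need not be computed again.\<close>

lemma taylor_taylor:
  assumes G: "G \<in> faces V i" and H: "H \<in> faces V (Suc (Suc i))"
  shows "mv (faces V (Suc i)) (taylor f) (\<lambda>F. taylor f F H) G = (0 :: ('n, 'k::field) mpol)"
proof -
  define e where "e = (\<lambda>F. if F = H then 1 else 0 :: ('n, 'k) mpol)"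
  have "mv (faces V (Suc (Suc i))) (taylor f) e = (\<lambda>F. taylor f F H)"
    unfolding e_def by (rule ext, rule mv_unit[OF finite_faces H])
  hence "mv (faces V (Suc i)) (taylor f) (\<lambda>F. taylor f F H) G =
      mv (faces V (Suc i)) (taylor f) (mv (faces V (Suc (Suc i))) (taylor f) e) G" by simp
  also have "\<dots> = (\<lambda>_. 0) G"
  proof (rule strand_eqD[OF _ G])
    fix u
    show "strand i u (mv (faces V (Suc i)) (taylor f) (mv (faces V (Suc (Suc i))) (taylor f) e)) G =
          strand i u (\<lambda>_. 0) G"
      using bd_bd[OF V finite_face[OF G], of "strand (Suc (Suc i)) u e"]
      by (simp add: bd_strand) (simp add: strand_def)
  qed
  finally show ?thesis .
qed

lemma taylor_free_res:
  "free_res (faces V) (\<lambda>_ F. int (lcm_deg f F)) (\<lambda>_. taylor f :: nat set \<Rightarrow> nat set \<Rightarrow> ('n, 'k::field) mpol) {}"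
proof
  show "homogeneous (int (lcm_deg f F) - int (lcm_deg f G)) (taylor f G F :: ('n, 'k) mpol)"
    if "F \<in> faces V (Suc i)" for F G i
  proof (cases "G \<subseteq> F")
    case True
    hence "mdvd (mon_lcm f G) (mon_lcm f F)" using finite_face[OF that] by (intro mon_lcm_mono)
    thus ?thesis using True
      by (auto simp: homogeneous_def taylor_def in_keys_iff lookup_single when_def mon_deg_diff lcm_deg_def)
  qed (simp add: taylor_def)
  show "faces V 0 = {{}}" using V finite_subset by (force simp: faces_def)
  show "finite (faces V i)" for i by (rule finite_faces)
  show "int (lcm_deg f {}) = 0" by (simp add: lcm_deg_def)
qed (fact taylor_taylor taylor_exact)+

end

subsection \<open>Resolutions with numbered bases\<close>

text \<open>Ensures that \<open>chosen_resolution\<close> really is a resolution. The bases are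
  numbered by bijections, and \<open>S\<close> at the end of the complex becomes the target of the
  augmentation.\<close>

lemma (in free_res) ex_graded_free_resolution: "\<exists>R. graded_free_resolution image R"
proof -
  define n where "n i = card (B i)" for i
  have "\<forall>i. \<exists>e. bij_betw e {..<n i} (B i)"
    using ex_bij_betw_nat_finite[OF finite_B] by (auto simp: n_def atLeast0LessThan)
  then obtain e where bij: "\<And>i. bij_betw (e i) {..<n i} (B i)" by metis
  define l where "l i v = (\<lambda>b. v (inv_into {..<n i} (e i) b))" for i and v :: "nat \<Rightarrow> ('n, 'k) mpol"
  have l: "l i v (e i b) = v b" if "b < n i" for i b v
    using bij_betw_inv_into_left[OF bij] that by (simp add: l_def)
  have e: "e i b \<in> B i" if "b < n i" for i b using bij[of i] that by (auto simp: bij_betw_def)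
  have eB: "\<exists>b<n i. c = e i b" if "c \<in> B i" for c i using bij[of i] that by (auto simp: bij_betw_def)
  have reindex: "mv (B i) A v a = mv {..<n i} (\<lambda>a b. A a (e i b)) (\<lambda>b. v (e i b)) a"
    for i v a and A :: "'b \<Rightarrow> 'b \<Rightarrow> ('n, 'k) mpol"
    unfolding mv_def by (rule sum.reindex_bij_betw[OF bij, symmetric])
  have mv_l: "mv (B i) A (l i v) a = mv {..<n i} (\<lambda>a b. A a (e i b)) v a"
    for i v a and A :: "'b \<Rightarrow> 'b \<Rightarrow> ('n, 'k) mpol"
    unfolding reindex by (rule mv_cong) (simp_all add: l)
  define R where "R = \<lparr>rk = \<lambda>i. n (Suc i), gdeg = \<lambda>i b. g (Suc i) (e (Suc i) b),
     aug = \<lambda>b. D 0 bot (e (Suc 0) b),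
     diff = \<lambda>i a b. D (Suc i) (e (Suc i) a) (e (Suc (Suc i)) b)\<rparr>"
  have dm: "diff_map R i w = (\<lambda>a. if a < n (Suc i) then
      mv (B (Suc (Suc i))) (D (Suc i)) (l (Suc (Suc i)) w) (e (Suc i) a) else 0)" for i w
    unfolding mv_l by (simp add: diff_map_def mat_map_def R_def mv_def fun_eq_iff)
  have am: "aug_map R w = mv (B (Suc 0)) (D 0) (l (Suc 0) w) bot" for w
    unfolding mv_l by (simp add: aug_map_def R_def mv_def)
  \<comment> \<open>One statement for both exactness conditions: for \<open>i = 0\<close> the left
    side is the kernel of the augmentation, for \<open>i = Suc h\<close> that of
    \<open>diff_map R h\<close>.\<close>
  have kernel: "(\<forall>a\<in>B i. mv (B (Suc i)) (D i) (l (Suc i) v) a = 0) \<longleftrightarrow>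
      v \<in> diff_map R i ` free_mod (n (Suc (Suc i)))" if v: "v \<in> free_mod (n (Suc i))" for i v
  proof
    assume "\<forall>a\<in>B i. mv (B (Suc i)) (D i) (l (Suc i) v) a = 0"
    with exact[of i "l (Suc i) v"] obtain w where
      w: "\<And>b. b \<in> B (Suc i) \<Longrightarrow> l (Suc i) v b = mv (B (Suc (Suc i))) (D (Suc i)) w b" by blast
    define w' where "w' c = (if c < n (Suc (Suc i)) then w (e (Suc (Suc i)) c) else 0)" for c
    have "l (Suc (Suc i)) w' c = w c" if "c \<in> B (Suc (Suc i))" for c
      using eB[OF that] by (auto simp: l w'_def)
    hence "mv (B (Suc (Suc i))) (D (Suc i)) (l (Suc (Suc i)) w') b =
        mv (B (Suc (Suc i))) (D (Suc i)) w b" for b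
      by (intro mv_cong) simp_all
    hence "diff_map R i w' b = v b" for b
      using v by (cases "b < n (Suc i)") (simp_all add: dm w[symmetric] e l free_mod_def)
    hence "diff_map R i w' = v" by blast
    moreover have "w' \<in> free_mod (n (Suc (Suc i)))" by (simp add: free_mod_def w'_def)
    ultimately show "v \<in> diff_map R i ` free_mod (n (Suc (Suc i)))" by blast
  next
    assume "v \<in> diff_map R i ` free_mod (n (Suc (Suc i)))"
    then obtain w where w: "v = diff_map R i w" by blast
    show "\<forall>a\<in>B i. mv (B (Suc i)) (D i) (l (Suc i) v) a = 0"
    proof
      fix a assume a: "a \<in> B i"
      have "l (Suc i) v b = mv (B (Suc (Suc i))) (D (Suc i)) (l (Suc (Suc i)) w) b"
        if "b \<in> B (Suc i)" for b
        using eB[OF that] by (auto simp: l w dm)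
      hence "mv (B (Suc i)) (D i) (l (Suc i) v) a =
          mv (B (Suc i)) (D i) (mv (B (Suc (Suc i))) (D (Suc i)) (l (Suc (Suc i)) w)) a"
        by (intro mv_cong) simp_all
      also have "\<dots> = 0"
        unfolding mv_assoc using DD[OF a] by (simp add: mv_def)
      finally show "mv (B (Suc i)) (D i) (l (Suc i) v) a = 0" .
    qed
  qed
  have "graded_free_resolution image R"
    unfolding graded_free_resolution_def
  proof (intro conjI allI impI)
    show "homogeneous (gdeg R 0 b) (aug R b)" if "b < rk R 0" for b
      using hom_D[of bot 0 "e (Suc 0) b"] that by (simp add: R_def e B_0 g_bot)
    show "homogeneous (gdeg R (Suc i) b - gdeg R i a) (diff R i a b)" if "a < rk R i" "b < rk R (Suc i)" for i a b
      using that by (simp add: R_def e hom_D)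
    show "aug_map R ` free_mod (rk R 0) = image"
    proof (intro equalityI subsetI)
      fix p assume "p \<in> image"
      then obtain v where v: "p = mv (B (Suc 0)) (D 0) v bot" by (auto simp: image_def)
      define v' where "v' b = (if b < n (Suc 0) then v (e (Suc 0) b) else 0)" for b
      have "l (Suc 0) v' c = v c" if "c \<in> B (Suc 0)" for c
        using eB[OF that] by (auto simp: l v'_def)
      hence "aug_map R v' = p" unfolding am v by (intro mv_cong) simp_all
      moreover have "v' \<in> free_mod (rk R 0)" by (simp add: free_mod_def v'_def R_def)
      ultimately show "p \<in> aug_map R ` free_mod (rk R 0)" by blast
    qed (auto simp: am image_def)
    have "diff_map R i w \<in> free_mod (n (Suc i))" for i w by (simp add: dm free_mod_def)
    moreover have "rk R i = n (Suc i)" for i by (simp add: R_def)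
    ultimately show "{v \<in> free_mod (rk R 0). aug_map R v = 0} = diff_map R 0 ` free_mod (rk R 1)"
      using kernel[of _ 0] by (auto simp: am B_0)
    show "{v \<in> free_mod (rk R (Suc i)). diff_map R i v = 0} =
        diff_map R (Suc i) ` free_mod (rk R (Suc (Suc i)))" for i
    proof -
      have "diff_map R i v = 0 \<longleftrightarrow> (\<forall>a\<in>B (Suc i). mv (B (Suc (Suc i))) (D (Suc i)) (l (Suc (Suc i)) v) a = 0)" for v
        unfolding dm fun_eq_iff using e by (auto dest!: eB split: if_splits)
      moreover have "diff_map R (Suc i) w \<in> free_mod (n (Suc (Suc i)))" for w
        by (simp add: dm free_mod_def)
      moreover have "rk R i = n (Suc i)" for i by (simp add: R_def)
      moreover have "(\<forall>a\<in>B (Suc i). mv (B (Suc (Suc i))) (D (Suc i)) (l (Suc (Suc i)) v) a = 0) \<longleftrightarrow>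
          v \<in> diff_map R (Suc i) ` free_mod (n (Suc (Suc (Suc i))))" if "v \<in> free_mod (n (Suc (Suc i)))" for v
        using that by (rule kernel)
      ultimately have eq: "v \<in> {v \<in> free_mod (rk R (Suc i)). diff_map R i v = 0} \<longleftrightarrow>
          v \<in> diff_map R (Suc i) ` free_mod (rk R (Suc (Suc i)))" for v
        by (cases "v \<in> free_mod (n (Suc (Suc i)))") auto
      show ?thesis by (rule set_eqI) (rule eq)
    qed
  qed
  thus ?thesis by blast
qed

section \<open>Numbered resolutions as exact complexes ending in S\<close>

primrec num_basis :: "'a free_data \<Rightarrow> nat \<Rightarrow> nat set" where
  "num_basis R 0 = {0}"
| "num_basis R (Suc i) = {..<rk R i}"

primrec num_deg :: "'a free_data \<Rightarrow> nat \<Rightarrow> nat \<Rightarrow> int" where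
  "num_deg R 0 = (\<lambda>_. 0)"
| "num_deg R (Suc i) = gdeg R i"

primrec num_mat :: "'a free_data \<Rightarrow> nat \<Rightarrow> nat \<Rightarrow> nat \<Rightarrow> 'a" where
  "num_mat R 0 = (\<lambda>_. aug R)"
| "num_mat R (Suc i) = diff R i"

lemma diff_map_mv:
  "diff_map R i w = (\<lambda>a. if a < rk R i then mv (num_basis R (Suc (Suc i))) (num_mat R (Suc i)) w a else 0)"
  by (simp add: diff_map_def mat_map_def mv_def fun_eq_iff)

lemma aug_map_mv: "aug_map R w = mv (num_basis R (Suc 0)) (num_mat R 0) w a"
  by (simp add: aug_map_def mv_def)

context
  fixes I :: "('n::finite, 'k::field) mpol set" and R
  assumes R: "graded_free_resolution I R"
begin

text \<open>Placing \<open>S\<close> with the single basis element 0 at the end unifies exactness at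
  the augmentation with exactness further up.\<close>

lemma resolution_kernel:
  assumes "v \<in> free_mod (rk R i)"
  shows "(\<forall>a\<in>num_basis R i. mv (num_basis R (Suc i)) (num_mat R i) v a = 0) \<longleftrightarrow>
    v \<in> diff_map R i ` free_mod (rk R (Suc i))"
proof (cases i)
  case 0
  have "{v \<in> free_mod (rk R 0). aug_map R v = 0} = diff_map R 0 ` free_mod (rk R (Suc 0))"
    using R by (simp add: graded_free_resolution_def)
  hence "v \<in> diff_map R 0 ` free_mod (rk R (Suc 0)) \<longleftrightarrow> aug_map R v = 0"
    using assms 0 by blast
  thus ?thesis using 0 by (simp add: aug_map_mv[of R v 0])
next
  case (Suc h)
  have "{v \<in> free_mod (rk R (Suc h)). diff_map R h v = 0} = diff_map R (Suc h) ` free_mod (rk R (Suc (Suc h)))"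
    using R by (simp add: graded_free_resolution_def)
  hence "v \<in> diff_map R (Suc h) ` free_mod (rk R (Suc (Suc h))) \<longleftrightarrow> diff_map R h v = 0"
    using assms Suc by blast
  also have "\<dots> \<longleftrightarrow> (\<forall>a<rk R h. mv (num_basis R (Suc i)) (num_mat R i) v a = 0)"
    using Suc by (auto simp: diff_map_mv fun_eq_iff)
  finally show ?thesis using Suc by auto
qed

lemma resolution_free_res: "free_res (num_basis R) (num_deg R) (num_mat R) 0"
proof
  show "finite (num_basis R i)" for i by (cases i) simp_all
  show "homogeneous (num_deg R (Suc i) b - num_deg R i a) (num_mat R i a b)"
    if "a \<in> num_basis R i" "b \<in> num_basis R (Suc i)" for i a b
    using R that by (cases i) (auto simp: graded_free_resolution_def)
  show "mv (num_basis R (Suc i)) (num_mat R i) (\<lambda>b. num_mat R (Suc i) b c) a = 0"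
    if a: "a \<in> num_basis R i" and c: "c \<in> num_basis R (Suc (Suc i))" for i a c
  proof -
    \<comment> \<open>Column \<open>c\<close> is the image of a unit vector, and images equal
      kernels in a resolution.\<close>
    define u where "u = (\<lambda>b. if b = c then 1 else 0 :: ('n, 'k) mpol)"
    have u: "u \<in> free_mod (rk R (Suc i))" using c by (auto simp: u_def free_mod_def)
    have "diff_map R i u b = num_mat R (Suc i) b c" if "b \<in> num_basis R (Suc i)" for b
      using that c mv_unit[of "num_basis R (Suc (Suc i))" c "num_mat R (Suc i)" b]
      by (simp add: diff_map_mv u_def)
    moreover have "diff_map R i u \<in> free_mod (rk R i)" by (simp add: diff_map_mv free_mod_def)
    hence "\<forall>a\<in>num_basis R i. mv (num_basis R (Suc i)) (num_mat R i) (diff_map R i u) a = 0"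
      using u by (subst resolution_kernel) auto
    moreover have "mv (num_basis R (Suc i)) (num_mat R i) (\<lambda>b. num_mat R (Suc i) b c) a =
        mv (num_basis R (Suc i)) (num_mat R i) (diff_map R i u) a"
      by (rule mv_cong) (simp_all add: calculation(1))
    ultimately show ?thesis using a by simp
  qed
  show "\<exists>w. \<forall>b\<in>num_basis R (Suc i). v b = mv (num_basis R (Suc (Suc i))) (num_mat R (Suc i)) w b"
    if v: "\<And>a. a \<in> num_basis R i \<Longrightarrow> mv (num_basis R (Suc i)) (num_mat R i) v a = 0" for i v
  proof -
    \<comment> \<open>\<open>free_mod\<close> demands zeros beyond the rank, whereas vectors in
      \<open>free_res\<close> are unconstrained off the basis; hence the truncation.\<close>
    define v' where "v' b = (if b < rk R i then v b else 0)" for b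
    have "v' \<in> free_mod (rk R i)" by (simp add: v'_def free_mod_def)
    moreover have "mv (num_basis R (Suc i)) (num_mat R i) v' a = 0" if "a \<in> num_basis R i" for a
    proof -
      have "mv (num_basis R (Suc i)) (num_mat R i) v' a = mv (num_basis R (Suc i)) (num_mat R i) v a"
        by (rule mv_cong) (simp_all add: v'_def)
      thus ?thesis using v[OF that] by simp
    qed
    ultimately have "v' \<in> diff_map R i ` free_mod (rk R (Suc i))"
      using resolution_kernel by blast
    then obtain w where "v' = diff_map R i w" by blast
    moreover have "v b = v' b" if "b < rk R i" for b using that by (simp add: v'_def)
    ultimately have "v b = diff_map R i w b" if "b < rk R i" for b using that by simp
    thus ?thesis by (intro exI[of _ w]) (simp add: diff_map_mv)
  qed
qed simp_all

lemma resolution_image: "free_res.image (num_basis R) (num_mat R) 0 = I"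
proof -
  interpret F: free_res "num_basis R" "num_deg R" "num_mat R" 0 by (rule resolution_free_res)
  have "F.image = range (aug_map R)" unfolding F.image_def by (simp add: aug_map_mv[of R _ 0, abs_def])
  also have "\<dots> = aug_map R ` free_mod (rk R 0)"
  proof (intro equalityI subsetI)
    fix p assume "p \<in> range (aug_map R)"
    then obtain v where v: "p = aug_map R v" by blast
    define v' where "v' b = (if b < rk R 0 then v b else 0)" for b
    have "aug_map R v' = p" by (simp add: v aug_map_def v'_def)
    moreover have "v' \<in> free_mod (rk R 0)" by (simp add: v'_def free_mod_def)
    ultimately show "p \<in> aug_map R ` free_mod (rk R 0)" by blast
  qed auto
  also have "\<dots> = I" using R by (simp add: graded_free_resolution_def)
  finally show ?thesis .
qed

lemma diff_k_mv:
  "diff_k R i w = (\<lambda>a. if a < rk R i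
     then mv (num_basis R (Suc (Suc i))) (cc (num_mat R (Suc i))) w a else 0)"
  by (simp add: diff_k_def mat_map_def mv_def fun_eq_iff)

text \<open>Both sides speak of the same vectors up to values off the basis, which
  \<open>tensor_k\<close> fixes at zero. Neither imposes a cycle condition for
  \<open>i = 0\<close>.\<close>

lemma resolution_tor_nz:
  "quotient_group (tor_cycles R i j) (tor_boundaries R i j) \<noteq> {tor_boundaries R i j} \<longleftrightarrow>
   free_res.tor_nz (num_basis R) (num_deg R) (num_mat R) i j"
proof -
  interpret F: free_res "num_basis R" "num_deg R" "num_mat R" 0 by (rule resolution_free_res)
  have "quotient_group (tor_cycles R i j) (tor_boundaries R i j) \<noteq> {tor_boundaries R i j} \<longleftrightarrow>
      (\<exists>z\<in>tor_cycles R i j. z \<notin> tor_boundaries R i j)"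
  proof (rule quotient_group_nonzero_iff)
    have d0: "diff_k R i 0 = 0" for i by (simp add: diff_k_mv mv_def fun_eq_iff)
    have t0: "0 \<in> tensor_k R i j" for i by (simp add: tensor_k_def free_mod_def)
    show "0 \<in> tor_boundaries R i j" unfolding tor_boundaries_def using t0 d0 by (metis image_eqI)
    show "0 \<in> tor_cycles R i j" using t0 d0 by (simp add: tor_cycles_def split: nat.split)
    fix x assume "x \<in> tor_boundaries R i j"
    then obtain v where v: "v \<in> tensor_k R (Suc i) j" "x = diff_k R i v" by (auto simp: tor_boundaries_def)
    have "- v \<in> tensor_k R (Suc i) j" using v by (simp add: tensor_k_def free_mod_def)
    moreover have "diff_k R i (- v) = - x"
      by (simp add: v diff_k_mv mv_def fun_eq_iff sum_negf)
    ultimately show "- x \<in> tor_boundaries R i j" unfolding tor_boundaries_def by (metis image_eqI)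
    fix y assume "y \<in> tor_boundaries R i j"
    then obtain w where w: "w \<in> tensor_k R (Suc i) j" "y = diff_k R i w" by (auto simp: tor_boundaries_def)
    have "gdeg R (Suc i) b = j" if "v b + w b \<noteq> 0" for b
      using v(1) w(1) that by (cases "v b = 0") (simp_all add: tensor_k_def)
    hence "v + w \<in> tensor_k R (Suc i) j" using v w by (simp add: tensor_k_def free_mod_def)
    moreover have "diff_k R i (v + w) = x + y"
      by (simp add: v w diff_k_mv mv_def fun_eq_iff algebra_simps sum.distrib)
    ultimately show "x + y \<in> tor_boundaries R i j" unfolding tor_boundaries_def by (metis image_eqI)
  qed
  also have "\<dots> \<longleftrightarrow> F.tor_nz i j"
  proof
    assume "\<exists>z\<in>tor_cycles R i j. z \<notin> tor_boundaries R i j"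
    then obtain z where z: "z \<in> tor_cycles R i j" "z \<notin> tor_boundaries R i j" by blast
    show "F.tor_nz i j" unfolding F.tor_nz_def
    proof (intro exI[of _ z] conjI ballI impI notI)
      show "num_deg R (Suc i) b = j" if "z b \<noteq> 0" for b
        using z(1) that by (simp add: tor_cycles_def tensor_k_def)
      show "mv (num_basis R (Suc i)) (cc (num_mat R i)) z a = 0" if i: "i \<noteq> 0" and a: "a \<in> num_basis R i" for a
      proof -
        obtain h where h: "i = Suc h" using i by (cases i) auto
        have "diff_k R h z a = 0" using z(1) h by (simp add: tor_cycles_def)
        thus ?thesis using a h by (simp add: diff_k_mv)
      qed
      assume "\<exists>w. (\<forall>c\<in>num_basis R (Suc (Suc i)). w c \<noteq> 0 \<longrightarrow> num_deg R (Suc (Suc i)) c = j) \<and>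
        (\<forall>b\<in>num_basis R (Suc i). z b = mv (num_basis R (Suc (Suc i))) (cc (num_mat R (Suc i))) w b)"
      then obtain w where w: "\<forall>c\<in>num_basis R (Suc (Suc i)). w c \<noteq> 0 \<longrightarrow> num_deg R (Suc (Suc i)) c = j"
        and zw: "\<forall>b\<in>num_basis R (Suc i). z b = mv (num_basis R (Suc (Suc i))) (cc (num_mat R (Suc i))) w b"
        by (elim exE conjE)
      define w' where "w' c = (if c < rk R (Suc i) then w c else 0)" for c
      have "w' \<in> tensor_k R (Suc i) j" using w by (auto simp: tensor_k_def free_mod_def w'_def)
      moreover have "diff_k R i w' b = z b" for b
      proof (cases "b < rk R i")
        case True
        have "mv (num_basis R (Suc (Suc i))) (cc (num_mat R (Suc i))) w' b =
              mv (num_basis R (Suc (Suc i))) (cc (num_mat R (Suc i))) w b"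
          by (rule mv_cong) (simp_all add: w'_def)
        thus ?thesis using True zw by (simp add: diff_k_mv)
      next
        case False
        thus ?thesis using z(1) by (simp add: diff_k_mv tor_cycles_def tensor_k_def free_mod_def)
      qed
      hence "diff_k R i w' = z" by (rule ext)
      ultimately show False using z(2) unfolding tor_boundaries_def by blast
    qed
  next
    assume "F.tor_nz i j"
    then obtain z where z: "\<forall>b\<in>num_basis R (Suc i). z b \<noteq> 0 \<longrightarrow> num_deg R (Suc i) b = j"
      and zc: "i \<noteq> 0 \<longrightarrow> (\<forall>a\<in>num_basis R i. mv (num_basis R (Suc i)) (cc (num_mat R i)) z a = 0)"
      and zb: "\<not> (\<exists>w. (\<forall>c\<in>num_basis R (Suc (Suc i)). w c \<noteq> 0 \<longrightarrow> num_deg R (Suc (Suc i)) c = j) \<and>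
        (\<forall>b\<in>num_basis R (Suc i). z b = mv (num_basis R (Suc (Suc i))) (cc (num_mat R (Suc i))) w b))"
      unfolding F.tor_nz_def by (elim exE conjE)
    define z' where "z' b = (if b < rk R i then z b else 0)" for b
    have "mv (num_basis R (Suc i)) (cc (num_mat R i)) z' a = mv (num_basis R (Suc i)) (cc (num_mat R i)) z a" for a
      by (rule mv_cong) (simp_all add: z'_def)
    with zc z have "z' \<in> tor_cycles R i j"
      by (auto simp: tor_cycles_def tensor_k_def free_mod_def z'_def diff_k_mv fun_eq_iff split: nat.split)
    moreover have "z' \<notin> tor_boundaries R i j"
    proof
      assume "z' \<in> tor_boundaries R i j"
      then obtain w where w: "w \<in> tensor_k R (Suc i) j" "z' = diff_k R i w" by (auto simp: tor_boundaries_def)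
      have "z b = z' b" if "b < rk R i" for b using that by (simp add: z'_def)
      with w(2) have "z b = diff_k R i w b" if "b < rk R i" for b using that by simp
      hence "\<exists>w. (\<forall>c\<in>num_basis R (Suc (Suc i)). w c \<noteq> 0 \<longrightarrow> num_deg R (Suc (Suc i)) c = j) \<and>
        (\<forall>b\<in>num_basis R (Suc i). z b = mv (num_basis R (Suc (Suc i))) (cc (num_mat R (Suc i))) w b)"
        using w(1) by (intro exI[of _ w]) (simp add: diff_k_mv tensor_k_def)
      with zb show False by (rule notE)
    qed
    ultimately show "\<exists>z\<in>tor_cycles R i j. z \<notin> tor_boundaries R i j" by blast
  qed
  finally show ?thesis .
qed

end

text \<open>The chosen resolution exists and has the same image ideal, so the comparison of
  complexes applies to it. Hence \<open>Tor\<close> may be read off from any exact complex of this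
  kind.\<close>

lemma Tor_nonzero_iff:
  assumes "free_res B g D bot"
  shows "Tor_nonzero (free_res.image B D bot) i j \<longleftrightarrow> free_res.tor_nz B g D i j"
proof -
  interpret L: free_res B g D bot by fact
  have R: "graded_free_resolution L.image (chosen_resolution L.image)"
    unfolding chosen_resolution_def using L.ex_graded_free_resolution by (rule someI_ex)
  let ?R = "chosen_resolution L.image"
  interpret N: free_res "num_basis ?R" "num_deg ?R" "num_mat ?R" 0 by (rule resolution_free_res[OF R])
  interpret free_res_pair B g D bot "num_basis ?R" "num_deg ?R" "num_mat ?R" 0
    by unfold_locales (simp add: resolution_image[OF R])
  show ?thesis unfolding Tor_nonzero_def Tor_def resolution_tor_nz[OF R] tor_nz_iff ..
qed

subsection \<open>Regularity from the Taylor complex\<close>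

text \<open>The lcm of the empty face is 1, so \<open>{l}\<close> maps to \<open>f l\<close> with
  positive sign and the image consists of the linear combinations of the generators.\<close>

lemma taylor_image:
  fixes f :: "nat \<Rightarrow> 'n::finite mon"
  assumes V: "finite V"
  shows "free_res.image (faces V) (\<lambda>_. taylor f) {} =
    (ideal_gen ((\<lambda>l. monomial (f l)) ` V) :: ('n, 'k::field) mpol set)"
proof -
  interpret T: free_res "faces V" "\<lambda>_ F. int (lcm_deg f F)"
      "\<lambda>_. taylor f :: nat set \<Rightarrow> nat set \<Rightarrow> ('n, 'k) mpol" "{}"
    by (rule taylor_free_res[OF V])
  interpret M: module "(*) :: ('n, 'k) mpol \<Rightarrow> ('n, 'k) mpol \<Rightarrow> ('n, 'k) mpol" by (rule module_mult)
  let ?S = "(\<lambda>l. monomial (f l) :: ('n, 'k) mpol) ` V"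
  have mv: "mv (faces V 1) (taylor f) x {} = (\<Sum>l\<in>V. x {l} * (monomial (f l) :: ('n, 'k) mpol))" for x
    using mv_taylor[OF V, of "{}" 0 f x] V by (simp add: faces_def mult.commute)
  have "T.image = M.span ?S"
  proof
    show "T.image \<subseteq> M.span ?S"
      unfolding T.image_def mv by (intro image_subsetI M.span_sum M.span_scale, rule M.span_base) simp
    show "M.span ?S \<subseteq> T.image"
    proof (rule M.span_minimal)
      show "?S \<subseteq> T.image"
      proof
        fix p assume "p \<in> ?S"
        then obtain l where l: "l \<in> V" "p = monomial (f l)" by blast
        have "p = (\<Sum>l'\<in>V. (if {l'} = {l} then 1 else 0) * (monomial (f l') :: ('n, 'k) mpol))"
          using l V by (simp add: if_distrib[of "\<lambda>x. x * _"] cong: if_cong)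
        thus "p \<in> T.image" unfolding T.image_def mv
          by (intro image_eqI[of _ _ "\<lambda>F. if F = {l} then 1 else 0"]) auto
      qed
      show "M.subspace T.image"
      proof (rule M.subspaceI)
        show "0 \<in> T.image" unfolding T.image_def mv
          by (intro image_eqI[of _ _ "\<lambda>_. 0"]) auto
        fix p assume "p \<in> T.image"
        then obtain x where x: "p = (\<Sum>l\<in>V. x {l} * (monomial (f l) :: ('n, 'k) mpol))"
          unfolding T.image_def mv by blast
        show "c * p \<in> T.image" for c
        proof -
          have "c * p = (\<Sum>l\<in>V. c * x {l} * monomial (f l))"
            unfolding x sum_distrib_left by (simp only: mult.assoc)
          thus ?thesis unfolding T.image_def mv by (rule range_eqI[of _ _ "\<lambda>F. c * x F"])
        qed
        fix q assume "q \<in> T.image"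
        then obtain y where y: "q = (\<Sum>l\<in>V. y {l} * (monomial (f l) :: ('n, 'k) mpol))"
          unfolding T.image_def mv by blast
        have "p + q = (\<Sum>l\<in>V. (x {l} + y {l}) * monomial (f l))"
          unfolding x y by (simp only: sum.distrib distrib_right)
        thus "p + q \<in> T.image" unfolding T.image_def mv by (rule range_eqI[of _ _ "\<lambda>F. x F + y F"])
      qed
    qed
  qed
  thus ?thesis by (simp add: ideal_gen_def)
qed

lemma lcm_deg_mono: "finite F \<Longrightarrow> G \<subseteq> F \<Longrightarrow> lcm_deg f G \<le> lcm_deg f F"
  unfolding lcm_deg_def by (intro mon_deg_mono mon_lcm_mono)

text \<open>Here the Taylor complex tensored with \<open>k\<close> turns into relative chains. An
  entry has a constant coefficient only if the two lcm degrees agree, and \<open>z\<close> is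
  supported in degree \<open>j\<close>: either all cofaces of \<open>G\<close> in the support count,
  or none does.\<close>

lemma mv_cc_taylor:
  fixes f :: "nat \<Rightarrow> 'n::finite mon" and z :: "nat set \<Rightarrow> 'k::field"
  assumes V: "finite V" and G: "G \<in> faces V i"
    and z: "\<And>F. F \<in> faces V (Suc i) \<Longrightarrow> z F \<noteq> 0 \<Longrightarrow> lcm_deg f F = j"
  shows "mv (faces V (Suc i)) (cc (taylor f)) z G = (if lcm_deg f G = j then bd V z G else 0)"
proof -
  have G': "G \<subseteq> V" "card G = i" "finite G" using G V finite_subset by (auto simp: faces_def)
  have "mv (faces V (Suc i)) (cc (taylor f)) z G =
      (\<Sum>v\<in>V - G. Poly_Mapping.lookup (taylor f G (insert v G)) 0 * z (insert v G))"
    unfolding mv_def by (rule sum_faces[OF V G]) (simp add: taylor_def)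
  also have "\<dots> = (\<Sum>v\<in>V - G. if lcm_deg f G = j then (-1) ^ card {w\<in>G. w < v} * z (insert v G) else 0)"
  proof (rule sum.cong)
    fix v assume v: "v \<in> V - G"
    hence F: "insert v G \<in> faces V (Suc i)" and vG: "insert v G - G = {v}"
      using G' by (auto simp: faces_def)
    have "mdvd (mon_lcm f G) (mon_lcm f (insert v G))" using G' by (intro mon_lcm_mono) auto
    hence "mon_lcm f (insert v G) - mon_lcm f G = 0 \<longleftrightarrow> lcm_deg f (insert v G) = lcm_deg f G"
      unfolding lcm_deg_def by (rule mdvd_diff_eq_0_iff)
    thus "Poly_Mapping.lookup (taylor f G (insert v G)) 0 * z (insert v G) =
        (if lcm_deg f G = j then (-1) ^ card {w\<in>G. w < v} * z (insert v G) else 0)"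
      using z[OF F] vG by (cases "z (insert v G) = 0") (auto simp: taylor_def lookup_single when_def)
  qed simp
  also have "\<dots> = (if lcm_deg f G = j then bd V z G else 0)" by (simp add: bd_def)
  finally show ?thesis .
qed

text \<open>The delicate point is the empty face, at which relative chains may have a boundary while
  \<open>Tor\<close> imposes no condition. Its lcm degree is 0 and \<open>pos\<close> puts all
  nonempty faces in positive degree, so it never meets the level \<open>m\<close>.\<close>

lemma tor_nz_taylor_iff:
  fixes f :: "nat \<Rightarrow> 'n::finite mon"
  assumes V: "finite V" and pos: "\<And>F. F \<subseteq> V \<Longrightarrow> F \<noteq> {} \<Longrightarrow> 0 < lcm_deg f F"
  shows "free_res.tor_nz (faces V) (\<lambda>_ F. int (lcm_deg f F))
      (\<lambda>_. taylor f :: nat set \<Rightarrow> nat set \<Rightarrow> ('n, 'k::field) mpol) p j \<longleftrightarrow>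
    (\<exists>m. j = int m \<and> 0 < m \<and> rel_nz TYPE('k) V (lcm_deg f) (Suc p) m)"
proof -
  interpret T: free_res "faces V" "\<lambda>_ F. int (lcm_deg f F)"
      "\<lambda>_. taylor f :: nat set \<Rightarrow> nat set \<Rightarrow> ('n, 'k) mpol" "{}"
    by (rule taylor_free_res[OF V])
  have outside: "bd V c G = 0" if "\<And>F. c F \<noteq> 0 \<Longrightarrow> F \<in> faces V (Suc i)" "G \<notin> faces V i"
    for c :: "nat set \<Rightarrow> 'k" and G i
  proof (rule ccontr)
    assume "bd V c G \<noteq> 0"
    then obtain v where v: "v \<in> V" "v \<notin> G" "c (insert v G) \<noteq> 0" by (rule bd_nonzeroD)
    have F: "insert v G \<in> faces V (Suc i)" by (rule that(1)[OF v(3)])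
    have "finite G" using finite_face[OF V F] by simp
    hence "G \<in> faces V i" using F v by (auto simp: faces_def)
    with that(2) show False ..
  qed
  show ?thesis
  proof
    assume "T.tor_nz p j"
    then obtain z :: "nat set \<Rightarrow> 'k"
      where z: "\<forall>F\<in>faces V (Suc p). z F \<noteq> 0 \<longrightarrow> int (lcm_deg f F) = j"
      and zc: "p \<noteq> 0 \<longrightarrow> (\<forall>G\<in>faces V p. mv (faces V (Suc p)) (cc (taylor f)) z G = 0)"
      and zb: "\<not> (\<exists>w. (\<forall>F\<in>faces V (Suc (Suc p)). w F \<noteq> 0 \<longrightarrow> int (lcm_deg f F) = j) \<and>
            (\<forall>F\<in>faces V (Suc p). z F = mv (faces V (Suc (Suc p))) (cc (taylor f)) w F))"
      unfolding T.tor_nz_def by (elim exE conjE)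
    \<comment> \<open>Otherwise \<open>z\<close> would be the boundary of 0. A face in the support
      shows that \<open>j\<close> is the lcm degree of a nonempty face, hence positive.\<close>
    have "\<exists>F\<in>faces V (Suc p). z F \<noteq> 0"
    proof (rule ccontr)
      assume "\<not> ?thesis"
      hence "\<exists>w. (\<forall>F\<in>faces V (Suc (Suc p)). w F \<noteq> 0 \<longrightarrow> int (lcm_deg f F) = j) \<and>
            (\<forall>F\<in>faces V (Suc p). z F = mv (faces V (Suc (Suc p))) (cc (taylor f)) w F)"
        by (intro exI[of _ "\<lambda>_. 0"]) (simp add: mv_def)
      with zb show False by (rule notE)
    qed
    then obtain F0 where F0: "F0 \<in> faces V (Suc p)" "z F0 \<noteq> 0" by blast
    define m where "m = lcm_deg f F0"
    have j: "j = int m" using z F0 by (simp add: m_def)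
    have "F0 \<noteq> {}" using F0 by (auto simp: faces_def)
    hence m: "0 < m" using F0 pos by (auto simp: m_def faces_def)
    define z' where "z' F = (if F \<in> faces V (Suc p) then z F else 0)" for F
    have z': "F \<in> faces V (Suc p) \<and> lcm_deg f F = m" if "z' F \<noteq> 0" for F
      using z that by (auto simp: z'_def j split: if_splits)
    have mvz: "mv (faces V (Suc p)) (cc (taylor f)) z G = mv (faces V (Suc p)) (cc (taylor f)) z' G" for G
      by (rule mv_cong) (simp_all add: z'_def)
    have zc': "bd V z' G = 0" if G: "lcm_deg f G = m" for G
    proof (cases "G \<in> faces V p")
      case True
      have "p \<noteq> 0"
      proof
        assume "p = 0"
        hence "G = {}" using True finite_face[OF V True] by (auto simp: faces_def)
        with G m show False by (simp add: lcm_deg_def)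
      qed
      hence "mv (faces V (Suc p)) (cc (taylor f)) z' G = 0" using zc True mvz by simp
      thus ?thesis using mv_cc_taylor[OF V True, of z' f m] z' G by simp
    next
      case False
      thus ?thesis using z' by (intro outside[of z' p]) auto
    qed
    have "\<not> (\<exists>w. (\<forall>F. w F \<noteq> 0 \<longrightarrow> F \<subseteq> V \<and> lcm_deg f F = m \<and> card F = Suc (Suc p)) \<and>
            (\<forall>F. lcm_deg f F = m \<longrightarrow> bd V w F = z' F))"
    proof
      assume "\<exists>w. (\<forall>F. w F \<noteq> 0 \<longrightarrow> F \<subseteq> V \<and> lcm_deg f F = m \<and> card F = Suc (Suc p)) \<and>
            (\<forall>F. lcm_deg f F = m \<longrightarrow> bd V w F = z' F)"
      then obtain w where w: "\<And>F. w F \<noteq> 0 \<Longrightarrow> F \<subseteq> V \<and> lcm_deg f F = m \<and> card F = Suc (Suc p)"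
        and bw: "\<And>F. lcm_deg f F = m \<Longrightarrow> bd V w F = z' F" by blast
      have "z F = mv (faces V (Suc (Suc p))) (cc (taylor f)) w F" if F: "F \<in> faces V (Suc p)" for F
      proof -
        have "mv (faces V (Suc (Suc p))) (cc (taylor f)) w F = (if lcm_deg f F = m then bd V w F else 0)"
          by (rule mv_cc_taylor[OF V F]) (simp add: w)
        also have "\<dots> = z' F" using bw[of F] z'[of F] by (cases "z' F = 0") auto
        finally show ?thesis using F by (simp add: z'_def)
      qed
      hence "\<exists>w. (\<forall>F\<in>faces V (Suc (Suc p)). w F \<noteq> 0 \<longrightarrow> int (lcm_deg f F) = j) \<and>
            (\<forall>F\<in>faces V (Suc p). z F = mv (faces V (Suc (Suc p))) (cc (taylor f)) w F)"
        using w by (intro exI[of _ w]) (auto simp: j)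
      with zb show False by (rule notE)
    qed
    hence "rel_nz TYPE('k) V (lcm_deg f) (Suc p) m"
      unfolding rel_nz_def using z' zc' by (intro exI[of _ z']) (auto simp: faces_def)
    with j m show "\<exists>m. j = int m \<and> 0 < m \<and> rel_nz TYPE('k) V (lcm_deg f) (Suc p) m" by blast
  next
    assume "\<exists>m. j = int m \<and> 0 < m \<and> rel_nz TYPE('k) V (lcm_deg f) (Suc p) m"
    then obtain m where j: "j = int m" and rel: "rel_nz TYPE('k) V (lcm_deg f) (Suc p) m" by blast
    then obtain z :: "nat set \<Rightarrow> 'k" where
      z: "\<And>F. z F \<noteq> 0 \<Longrightarrow> F \<subseteq> V \<and> lcm_deg f F = m \<and> card F = Suc p"
      and zc: "\<And>G. lcm_deg f G = m \<Longrightarrow> bd V z G = 0"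
      and zb: "\<not> (\<exists>w. (\<forall>F. w F \<noteq> 0 \<longrightarrow> F \<subseteq> V \<and> lcm_deg f F = m \<and> card F = Suc (Suc p)) \<and>
            (\<forall>F. lcm_deg f F = m \<longrightarrow> bd V w F = z F))"
      unfolding rel_nz_def by blast
    show "T.tor_nz p j" unfolding T.tor_nz_def
    proof (intro exI[of _ z] conjI ballI impI notI)
      show "int (lcm_deg f F) = j" if "z F \<noteq> 0" for F using z[OF that] j by simp
      show "mv (faces V (Suc p)) (cc (taylor f)) z G = 0" if "G \<in> faces V p" for G
      proof -
        have "mv (faces V (Suc p)) (cc (taylor f)) z G = (if lcm_deg f G = m then bd V z G else 0)"
          by (rule mv_cc_taylor[OF V that]) (simp add: z)
        thus ?thesis using zc[of G] by simp
      qed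
      assume "\<exists>w. (\<forall>F\<in>faces V (Suc (Suc p)). w F \<noteq> 0 \<longrightarrow> int (lcm_deg f F) = j) \<and>
            (\<forall>F\<in>faces V (Suc p). z F = mv (faces V (Suc (Suc p))) (cc (taylor f)) w F)"
      then obtain w :: "nat set \<Rightarrow> 'k"
        where w: "\<forall>F\<in>faces V (Suc (Suc p)). w F \<noteq> 0 \<longrightarrow> int (lcm_deg f F) = j"
        and zw: "\<forall>F\<in>faces V (Suc p). z F = mv (faces V (Suc (Suc p))) (cc (taylor f)) w F"
        by (elim exE conjE)
      define w' where "w' F = (if F \<in> faces V (Suc (Suc p)) then w F else 0)" for F
      have w': "F \<in> faces V (Suc (Suc p)) \<and> lcm_deg f F = m" if "w' F \<noteq> 0" for F
        using w that by (auto simp: w'_def j split: if_splits)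
      have "bd V w' F = z F" if F: "lcm_deg f F = m" for F
      proof (cases "F \<in> faces V (Suc p)")
        case True
        have "mv (faces V (Suc (Suc p))) (cc (taylor f)) w F = mv (faces V (Suc (Suc p))) (cc (taylor f)) w' F"
          by (rule mv_cong) (simp_all add: w'_def)
        also have "\<dots> = (if lcm_deg f F = m then bd V w' F else 0)"
          by (rule mv_cc_taylor[OF V True]) (simp add: w')
        finally show ?thesis using zw True F by simp
      next
        case False
        hence "z F = 0" using z by (auto simp: faces_def)
        moreover have "bd V w' F = 0" using w' False by (intro outside[of w' "Suc p"]) auto
        ultimately show ?thesis by simp
      qed
      hence "\<exists>w. (\<forall>F. w F \<noteq> 0 \<longrightarrow> F \<subseteq> V \<and> lcm_deg f F = m \<and> card F = Suc (Suc p)) \<and>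
            (\<forall>F. lcm_deg f F = m \<longrightarrow> bd V w F = z F)"
        using w' by (intro exI[of _ w']) (simp add: faces_def)
      with zb show False by (rule notE)
    qed
  qed
qed

lemma lcm_complex_eq: "lcm_complex r f (int m) = {F. F \<subseteq> {1..r} \<and> lcm_deg f F \<le> m}"
  by (simp add: lcm_complex_def lcm_deg_def)

text \<open>For negative \<open>j\<close> not even the empty face qualifies; the complex is void and
  has no homology, which allows \<open>j\<close> to be a natural number on the right.\<close>

lemma reduced_homology_nonzero_lcm_complex_iff:
  "reduced_homology_nonzero (T :: 'k::field itself) (lcm_complex r f j) i \<longleftrightarrow>
    (\<exists>m q. j = int m \<and> i = int q - 1 \<and> hom_nz T {1..r} {F. F \<subseteq> {1..r} \<and> lcm_deg f F \<le> m} q)"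
proof (cases "0 \<le> j")
  case True
  then obtain m where m: "j = int m" using nonneg_int_cases by blast
  show ?thesis unfolding m lcm_complex_eq
    by (subst reduced_homology_nonzero_iff[of "{1..r}"]) auto
next
  case False
  hence "lcm_complex r f j = {}" by (auto simp: lcm_complex_def)
  hence "reduced_homology_nonzero T (lcm_complex r f j) i \<longleftrightarrow> (\<exists>q. i = int q - 1 \<and> hom_nz T {1..r} {} q)"
    by (subst reduced_homology_nonzero_iff[of "{1..r}"]) auto
  moreover have "\<not> hom_nz T {1..r} {} q" for q by (auto simp: hom_nz_def fun_eq_iff bd_def)
  ultimately show ?thesis using False by auto
qed

lemma ideal_gen_eq_UNIV:
  assumes "1 \<in> G"
  shows "ideal_gen G = (UNIV :: 'a::comm_ring_1 set)"
proof -
  interpret M: module "(*) :: 'a \<Rightarrow> 'a \<Rightarrow> 'a" by (rule module_mult)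
  have "p * 1 \<in> M.span G" for p using assms by (intro M.span_scale M.span_base)
  thus ?thesis by (auto simp: ideal_gen_def)
qed

theorem theorem7p2:
  fixes I :: "('n::finite, 'k::field) mpol set"
    and f :: "nat \<Rightarrow> 'n mon" and r :: nat
  assumes "monomial_ideal I"
    and "I \<noteq> {0}"
    and "min_mon_gens I r f"
  shows "regularity I =
    sup0 {j - i | i j. reduced_homology_nonzero TYPE('k) (lcm_complex r f j) i}"
proof -
  let ?V = "{1..r}" and ?\<mu> = "lcm_deg f" and ?T = "TYPE('k)"
  let ?H = "{j - i | i j. reduced_homology_nonzero ?T (lcm_complex r f j) i}"
  interpret M: module "(*) :: ('n, 'k) mpol \<Rightarrow> ('n, 'k) mpol \<Rightarrow> ('n, 'k) mpol" by (rule module_mult)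
  interpret T: free_res "faces ?V" "\<lambda>_ F. int (?\<mu> F)"
      "\<lambda>_. taylor f :: nat set \<Rightarrow> nat set \<Rightarrow> ('n, 'k) mpol" "{}"
    by (rule taylor_free_res) simp
  have gens: "ideal_gen ((\<lambda>l. monomial (f l)) ` ?V) = I"
    and minimal: "\<And>i. i \<in> ?V \<Longrightarrow> ideal_gen ((\<lambda>l. monomial (f l)) ` (?V - {i})) \<noteq> I"
    using assms(3) by (auto simp: min_mon_gens_def)
  have Tor: "Tor_nonzero I i j \<longleftrightarrow> T.tor_nz i j" for i j
    using Tor_nonzero_iff[OF T.free_res_axioms, of i j] gens by (simp add: taylor_image)
  have V: "?V \<noteq> {}"
  proof
    assume "?V = {}"
    hence "I = {0}" using gens by (simp add: ideal_gen_def)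
    with assms(2) show False ..
  qed
  have mono: "\<And>F G. G \<subseteq> F \<Longrightarrow> F \<subseteq> ?V \<Longrightarrow> ?\<mu> G \<le> ?\<mu> F"
    using finite_subset by (intro lcm_deg_mono) auto
  show ?thesis
  \<comment> \<open>A generator 1 means \<open>I = S\<close>. Its singleton face has lcm degree 0,
    so the positivity behind the passage to relative homology fails, and the convention of
    \<open>sup0\<close> for the empty set takes effect.\<close>
  proof (cases "\<exists>l\<in>?V. f l = 0")
    case True
    then obtain l where l: "l \<in> ?V" "f l = 0" by blast
    \<comment> \<open>The generator 1 spans \<open>S\<close> alone, so by minimality there is no
      other one.\<close>
    have "?V = {l}"
    proof (rule ccontr)
      assume "?V \<noteq> {l}"
      then obtain i where i: "i \<in> ?V" "i \<noteq> l" using l by blast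
      have "1 \<in> (\<lambda>l. monomial (f l) :: ('n, 'k) mpol) ` (?V - {i})" "1 \<in> (\<lambda>l. monomial (f l) :: ('n, 'k) mpol) ` ?V"
        using l i by (auto intro!: image_eqI[of _ _ l])
      with minimal[OF i(1)] gens show False by (simp add: ideal_gen_eq_UNIV)
    qed
    have \<mu>0: "?\<mu> F = 0" if "F \<subseteq> ?V" for F
    proof -
      have "F = {} \<or> F = {l}" using that \<open>?V = {l}\<close> by auto
      thus ?thesis using l by (auto simp: lcm_deg_def)
    qed
    have faces: "faces ?V (Suc 0) = {{l}}" "\<And>i. faces ?V (Suc (Suc i)) = {}"
      using \<open>?V = {l}\<close> by (auto simp: faces_def card_Suc_eq subset_singleton_iff)
    have \<mu>l: "?\<mu> {l} = 0" using \<mu>0[of "{l}"] l by simp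
    have "T.tor_nz i j \<longleftrightarrow> i = 0 \<and> j = 0" for i j
    proof (cases i)
      case 0
      show ?thesis
      proof (cases "j = 0")
        case True
        \<comment> \<open>With no cycle condition for \<open>p = 0\<close> and no face with two
          vertices, the constant function 1 on \<open>{l}\<close> is a nonzero class.\<close>
        have "T.tor_nz 0 0" unfolding T.tor_nz_def faces
          by (intro exI[of _ "\<lambda>_. 1"]) (simp add: mv_def \<mu>l)
        thus ?thesis using 0 True by simp
      next
        case False
        have "\<not> T.tor_nz 0 j" unfolding T.tor_nz_def faces
          using False by (auto simp: mv_def \<mu>l)
        thus ?thesis using 0 False by simp
      qed
    next
      case (Suc h)
      have "\<not> T.tor_nz (Suc h) j" unfolding T.tor_nz_def faces by auto
      thus ?thesis using Suc by simp
    qed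
    hence "{ereal (of_int (j - int i)) | i j. Tor_nonzero I i j} = {0}"
      by (auto simp: Tor zero_ereal_def)
    hence "regularity I = 0" by (simp add: regularity_def)
    moreover have "?H = {}"
    proof -
      \<comment> \<open>All faces have lcm degree 0, so every level \<open>m\<close> is the full
        simplex and coning stays inside it.\<close>
      have "\<not> hom_nz ?T ?V {F. F \<subseteq> ?V \<and> ?\<mu> F \<le> m} q" for m q
      proof
        assume "hom_nz ?T ?V {F. F \<subseteq> ?V \<and> ?\<mu> F \<le> m} q"
        then obtain z :: "nat set \<Rightarrow> 'k" where z: "\<And>F. z F \<noteq> 0 \<Longrightarrow> F \<subseteq> ?V \<and> card F = q"
          and zc: "\<And>G. bd ?V z G = 0"
          and zb: "\<not> (\<exists>w. (\<forall>F. w F \<noteq> 0 \<longrightarrow> F \<in> {F. F \<subseteq> ?V \<and> ?\<mu> F \<le> m} \<and> card F = Suc q) \<and> bd ?V w = z)"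
          unfolding hom_nz_def by (elim exE conjE) (rule that, simp_all)
        obtain w where "\<And>F. w F \<noteq> 0 \<Longrightarrow> F \<subseteq> ?V \<and> card F = Suc q" "bd ?V w = z"
          by (rule simplex_acyclic[of ?V z q]) (use V z zc in auto)
        hence "\<exists>w. (\<forall>F. w F \<noteq> 0 \<longrightarrow> F \<in> {F. F \<subseteq> ?V \<and> ?\<mu> F \<le> m} \<and> card F = Suc q) \<and> bd ?V w = z"
          by (intro exI[of _ w]) (simp add: \<mu>0)
        with zb show False by (rule notE)
      qed
      thus ?thesis by (simp add: reduced_homology_nonzero_lcm_complex_iff)
    qed
    ultimately show ?thesis by (simp add: sup0_def)
  next
    case False
    have pos: "0 < ?\<mu> F" if F: "F \<subseteq> ?V" "F \<noteq> {}" for F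
    proof -
      obtain l where l: "l \<in> F" using F by blast
      have "mon_deg (f l) \<noteq> 0" using False F l by (auto simp: mon_deg_eq_0_iff)
      moreover have "?\<mu> {l} \<le> ?\<mu> F" using F l by (intro mono) auto
      ultimately show ?thesis by (simp add: lcm_deg_def)
    qed
    let ?R = "{j - int i | i j. T.tor_nz i j}"
    have tor: "T.tor_nz p j \<longleftrightarrow> (\<exists>m. j = int m \<and> 0 < m \<and> rel_nz ?T ?V ?\<mu> (Suc p) m)" for p j
      by (rule tor_nz_taylor_iff) (use pos in auto)
    have RH: "?R \<subseteq> ?H"
    proof
      fix a assume "a \<in> ?R"
      then obtain p j where "a = j - int p" "T.tor_nz p j" by blast
      then obtain m where a: "a = int m - int p" "0 < m" and rel: "rel_nz ?T ?V ?\<mu> (Suc p) m"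
        unfolding tor by blast
      have "hom_nz ?T ?V {F. F \<subseteq> ?V \<and> ?\<mu> F \<le> m} (Suc p) \<or> hom_nz ?T ?V {F. F \<subseteq> ?V \<and> ?\<mu> F \<le> m - 1} p"
        by (rule rel_nz_imp_hom_nz[OF _ V mono rel \<open>0 < m\<close>]) simp
      thus "a \<in> ?H"
      proof
        assume "hom_nz ?T ?V {F. F \<subseteq> ?V \<and> ?\<mu> F \<le> m} (Suc p)"
        hence "reduced_homology_nonzero ?T (lcm_complex r f (int m)) (int p)"
          unfolding reduced_homology_nonzero_lcm_complex_iff by (intro exI[of _ m] exI[of _ "Suc p"]) simp
        thus ?thesis using a by blast
      next
        assume "hom_nz ?T ?V {F. F \<subseteq> ?V \<and> ?\<mu> F \<le> m - 1} p"
        hence "reduced_homology_nonzero ?T (lcm_complex r f (int (m - 1))) (int p - 1)"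
          unfolding reduced_homology_nonzero_lcm_complex_iff by (intro exI[of _ "m - 1"] exI[of _ p]) simp
        \<comment> \<open>Level and homological degree drop together; \<open>0 < m\<close> makes the
          natural subtraction exact.\<close>
        moreover have "a = int (m - 1) - (int p - 1)" using a by (simp add: of_nat_diff)
        ultimately show ?thesis by blast
      qed
    qed
    \<comment> \<open>A class in degree \<open>q - 1\<close> at level \<open>m\<close> that dies at
      level \<open>m'\<close> gives \<open>Tor\<close> in homological degree \<open>q\<close> and
      internal degree \<open>m'\<close>. Since \<open>m' > m\<close>, the difference
      \<open>m' - q\<close> is at least \<open>m - (q - 1)\<close>.\<close>
    have HR: "\<exists>b\<in>?R. a \<le> b" if "a \<in> ?H" for a
    proof -
      from that obtain m q where a: "a = int m - (int q - 1)"
        and hz: "hom_nz ?T ?V {F. F \<subseteq> ?V \<and> ?\<mu> F \<le> m} q"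
        unfolding reduced_homology_nonzero_lcm_complex_iff by blast
      obtain m' where m': "m < m'" "rel_nz ?T ?V ?\<mu> (Suc q) m'"
        by (rule hom_nz_imp_rel_nz[OF _ V mono hz]) (simp, assumption, assumption, rule that)
      have "0 < m'" using m'(1) by simp
      with m'(2) have "T.tor_nz q (int m')" unfolding tor by blast
      hence "int m' - int q \<in> ?R" by blast
      moreover have "a \<le> int m' - int q" using a m' by simp
      ultimately show ?thesis by blast
    qed
    \<comment> \<open>For proper \<open>I\<close> the complex of level 0 is \<open>{{}}\<close>,
      with homology in degree -1. Hence the set of differences is nonempty and \<open>sup0\<close>
      is the genuine supremum.\<close>
    have "hom_nz ?T ?V {F. F \<subseteq> ?V \<and> ?\<mu> F \<le> 0} 0"
      unfolding hom_nz_def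
    proof (intro exI[of _ "\<lambda>F. if F = {} then 1 else 0 :: 'k"] conjI allI impI notI)
      show "bd ?V (\<lambda>F. if F = {} then 1 else 0 :: 'k) G = 0" for G by (simp add: bd_def)
      assume "\<exists>w. (\<forall>F. w F \<noteq> 0 \<longrightarrow> F \<in> {F. F \<subseteq> ?V \<and> ?\<mu> F \<le> 0} \<and> card F = Suc 0) \<and>
        bd ?V w = (\<lambda>F. if F = {} then 1 else 0 :: 'k)"
      then obtain w where w: "\<And>F. w F \<noteq> 0 \<Longrightarrow> F \<subseteq> ?V \<and> ?\<mu> F \<le> 0 \<and> card F = Suc 0"
        and bw: "bd ?V w = (\<lambda>F. if F = {} then 1 else 0 :: 'k)" by auto
      have "w F = 0" for F
      proof (rule ccontr)
        assume "w F \<noteq> 0"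
        from w[OF this] have "F \<subseteq> ?V" "?\<mu> F = 0" "F \<noteq> {}" by auto
        with pos[of F] show False by simp
      qed
      hence "bd ?V w {} = 0" by (simp add: bd_def)
      thus False unfolding bw by simp
    qed (auto simp: lcm_deg_def split: if_splits)
    hence "reduced_homology_nonzero ?T (lcm_complex r f (int 0)) (- 1)"
      unfolding reduced_homology_nonzero_lcm_complex_iff by (intro exI[of _ 0]) simp
    hence "?H \<noteq> {}" by blast
    hence "sup0 ?H = (SUP a\<in>?H. ereal (of_int a))" unfolding sup0_def by (rule if_not_P)
    also have "\<dots> = (SUP a\<in>?R. ereal (of_int a))"
    proof (rule antisym)
      show "(SUP a\<in>?H. ereal (of_int a)) \<le> (SUP a\<in>?R. ereal (of_int a))"
      proof (rule SUP_mono)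
        fix a assume "a \<in> ?H"
        from HR[OF this] show "\<exists>b\<in>?R. ereal (of_int a) \<le> ereal (of_int b)" by auto
      qed
      show "(SUP a\<in>?R. ereal (of_int a)) \<le> (SUP a\<in>?H. ereal (of_int a))"
        by (rule SUP_subset_mono[OF RH]) simp
    qed
    also have "(\<lambda>a. ereal (of_int a)) ` ?R = {ereal (of_int (j - int i)) | i j. Tor_nonzero I i j}"
      unfolding Tor by blast
    finally show ?thesis by (simp add: regularity_def)
  qed
qed

end
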